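(* There is an absolute constant $C>0$ such that the following holds. Let $\delta>0$ and let $\mathcal X_0\in\mathrm{Gr}(n,k)$, $\mathcal X_0\ne\mathcal V_\alpha$, satisfy $\mathrm{dist}(\mathcal X_0,\mathcal V_\alpha)\le\frac\pi4$. Let $(\mathcal X_t)$ be the iterates of Riemannian steepest descent with step size $\frac1\gamma$, i.e. $\mathcal X_{t+1}=\mathrm{Exp}_{\mathcal X_t}\bigl(-\tfrac1\gamma\,\mathrm{grad}f(\mathcal X_t)\bigr)$. Then for all sufficiently small $\epsilon>0$ (depending on $A,k,\mathcal X_0$) there is an integer $$T\le C\,\frac\gamma\delta\,\log\frac{f(\mathcal X_0)-f^*}{\delta\,\epsilon}$$ such that $\mathrm{dist}(\mathcal X_T,\mathcal V_\alpha)\le\epsilon$; that is, accuracy $\epsilon$ is reached in at most $T=\mathcal O\bigl(\frac\gamma\delta\log\frac{f(\mathcal X_0)-f^*}{\delta\epsilon}\bigr)$ iterations.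
   Context: Let $1\le k\le n-1$ and let $A\in\mathbb R^{n\times n}$ be symmetric positive semidefinite with eigenvalues $\lambda_1\ge\cdots\ge\lambda_n$ (with multiplicity) and orthonormal eigenvectors $v_1,\dots,v_n$, $Av_i=\lambda_iv_i$. Put $\delta=\lambda_k-\lambda_{k+1}$, $\gamma=2(\lambda_1-\lambda_n)$ (so $\gamma>0$ when $\delta>0$) and $\mathcal V_\alpha=\mathrm{span}(v_1,\dots,v_k)$. $\mathrm{Gr}(n,k)$ is the Grassmann manifold of $k$-dimensional subspaces of $\mathbb R^n$; a subspace $\mathcal X=\mathrm{span}(X)$ is always represented by $X\in\mathbb R^{n\times k}$ with $X^TX=I_k$. Tangent vectors at $\mathcal X$ (for a given representative $X$) are the $G\in\mathbb R^{n\times k}$ with $X^TG=0$; the Riemannian metric is $\langle G_1,G_2\rangle=\mathrm{Tr}(G_1^TG_2)$. Exponential map: $\mathrm{Exp}_{\mathcal X}(G)=\mathrm{span}(XV\cos(\Sigma)+U\sin(\Sigma))$, where $G=U\Sigma V^T$ is a compact SVD with $\Sigma,V\in\mathbb R^{k\times k}$. The principal angles $0\le\theta_1\le\cdots\le\theta_k\le\pi/2$ between $\mathcal X=\mathrm{span}(X)$ and $\mathcal Y=\mathrm{span}(Y)$ are such that $\cos\theta_1,\dots,\cos\theta_k$ are the singular values of $Y^TX$; the Riemannian distance is $\mathrm{dist}(\mathcal X,\mathcal Y)=\sqrt{\theta_1^2+\cdots+\theta_k^2}$. The objective is $f:\mathrm{Gr}(n,k)\to\mathbb R$, $f(\mathcal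 X)=-\mathrm{Tr}(X^TAX)$, with Riemannian gradient $\mathrm{grad}f(\mathcal X)=-2(I-XX^T)AX$ and global minimum $f^*=-(\lambda_1+\cdots+\lambda_k)$. *)

theory Defs
  imports "Jordan_Normal_Form.VS_Connect"
begin

text \<open>
  The dimensions \<open>n\<close> and \<open>k\<close> are quantified inside one statement, with a constant not depending on
  them, so vectors and matrices are those of the AFP entry Jordan_Normal_Form, and a subspace
  of \<open>\<real>\<^sup>n\<close> is a set of vectors of dimension \<open>n\<close>. Matrix indices start at 0.
\<close>

abbreviation vspan :: "nat \<Rightarrow> real vec set \<Rightarrow> real vec set" where
  "vspan n \<equiv> LinearCombinations.module.span class_ring (module_vec TYPE(real) n)"

definition mtrace :: "real mat \<Rightarrow> real" where
  "mtrace M = (\<Sum>i<dim_row M. M $$ (i, i))"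

definition pos_semidef :: "nat \<Rightarrow> real mat \<Rightarrow> bool" where
  "pos_semidef n A \<longleftrightarrow>
     A \<in> carrier_mat n n \<and> A\<^sup>T = A \<and> (\<forall>x\<in>carrier_vec n. 0 \<le> x \<bullet> (A *\<^sub>v x))"

text \<open>
  Eigenvalues in decreasing order, with multiplicity, and an orthonormal eigenbasis, both indexed
  by \<open>1, \<dots>, n\<close>; values at other indices are irrelevant.
\<close>

definition eigensystem :: "nat \<Rightarrow> real mat \<Rightarrow> (nat \<Rightarrow> real) \<Rightarrow> (nat \<Rightarrow> real vec) \<Rightarrow> bool" where
  "eigensystem n A l v \<longleftrightarrow>
     (\<forall>i\<in>{1..n}. v i \<in> carrier_vec n \<and> A *\<^sub>v v i = l i \<cdot>\<^sub>v v i) \<and>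
     (\<forall>i\<in>{1..n}. \<forall>j\<in>{1..n}. v i \<bullet> v j = (if i = j then 1 else 0)) \<and>
     (\<forall>i\<in>{1..n}. \<forall>j\<in>{1..n}. i \<le> j \<longrightarrow> l j \<le> l i)"

definition Gr :: "nat \<Rightarrow> nat \<Rightarrow> real vec set set" where
  "Gr n k = {W. VectorSpace.subspace class_ring W (module_vec TYPE(real) n) \<and>
                vectorspace.dim class_ring (module_vec TYPE(real) n\<lparr>carrier := W\<rparr>) = k}"

definition stiefel :: "nat \<Rightarrow> nat \<Rightarrow> real mat set" where
  "stiefel n k = {X \<in> carrier_mat n k. X\<^sup>T * X = 1\<^sub>m k}"

definition represents :: "nat \<Rightarrow> nat \<Rightarrow> real mat \<Rightarrow> real vec set \<Rightarrow> bool" where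
  "represents n k X W \<longleftrightarrow> X \<in> stiefel n k \<and> vec_space.col_space n X = W"

text \<open>
  Two representatives of the same subspace differ by an orthogonal \<open>k \<times> k\<close> factor on the right.
  The trace and the singular values below are unchanged by such a factor, so neither
  \<open>objective\<close> nor \<open>gr_dist\<close> depends on the representative chosen here.
\<close>

definition rep :: "nat \<Rightarrow> nat \<Rightarrow> real vec set \<Rightarrow> real mat" where
  "rep n k W = (SOME X. represents n k X W)"

text \<open>
  \<open>compact_svd n k G U s V\<close>: \<open>G = U \<Sigma> V\<^sup>T\<close> with \<open>U\<close> of size \<open>n \<times> k\<close> having orthonormal columns,
  \<open>V\<close> orthogonal of size \<open>k \<times> k\<close> and \<open>\<Sigma> = diag (s 0, \<dots>, s (k - 1))\<close> nonnegative. Zero singular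
  values are allowed, and no ordering of \<open>s\<close> is imposed.
\<close>

definition compact_svd ::
    "nat \<Rightarrow> nat \<Rightarrow> real mat \<Rightarrow> real mat \<Rightarrow> (nat \<Rightarrow> real) \<Rightarrow> real mat \<Rightarrow> bool" where
  "compact_svd n k G U s V \<longleftrightarrow>
     U \<in> stiefel n k \<and> V \<in> stiefel k k \<and> (\<forall>i<k. 0 \<le> s i) \<and> G = U * mat_diag k s * V\<^sup>T"

text \<open>
  The exponential map at the subspace spanned by \<open>X\<close>, applied to a tangent vector \<open>G\<close> given with
  respect to \<open>X\<close>. The resulting subspace does not depend on the SVD chosen, although \<open>U\<close> and \<open>V\<close>
  are not unique.
\<close>

definition gr_exp :: "nat \<Rightarrow> nat \<Rightarrow> real mat \<Rightarrow> real mat \<Rightarrow> real vec set" where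
  "gr_exp n k X G =
     (let (U, s, V) = (SOME (U, s, V). compact_svd n k G U s V)
      in vec_space.col_space n
           (X * V * mat_diag k (\<lambda>i. cos (s i)) + U * mat_diag k (\<lambda>i. sin (s i))))"

definition principal_angles ::
    "nat \<Rightarrow> nat \<Rightarrow> real vec set \<Rightarrow> real vec set \<Rightarrow> (nat \<Rightarrow> real) \<Rightarrow> bool" where
  "principal_angles n k W Z \<theta> \<longleftrightarrow>
     (\<forall>i<k. 0 \<le> \<theta> i \<and> \<theta> i \<le> pi / 2) \<and> (\<forall>i j. i \<le> j \<and> j < k \<longrightarrow> \<theta> i \<le> \<theta> j) \<and>
     (\<exists>U V. compact_svd k k ((rep n k Z)\<^sup>T * rep n k W) U (\<lambda>i. cos (\<theta> i)) V)"

definition gr_dist :: "nat \<Rightarrow> nat \<Rightarrow> real vec set \<Rightarrow> real vec set \<Rightarrow> real" where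
  "gr_dist n k W Z =
     (let \<theta> = (SOME \<theta>. principal_angles n k W Z \<theta>) in sqrt (\<Sum>i<k. (\<theta> i)\<^sup>2))"

definition objective :: "nat \<Rightarrow> nat \<Rightarrow> real mat \<Rightarrow> real vec set \<Rightarrow> real" where
  "objective n k A W = - mtrace ((rep n k W)\<^sup>T * A * rep n k W)"

text \<open>
  By Ky Fan's theorem this is the global minimum of \<open>objective n k A\<close> over \<open>Gr n k\<close> when \<open>l\<close> lists
  the eigenvalues of \<open>A\<close> in decreasing order.
\<close>

definition objective_min :: "nat \<Rightarrow> (nat \<Rightarrow> real) \<Rightarrow> real" where
  "objective_min k l = - (\<Sum>i = 1..k. l i)"

text \<open>
  The Riemannian gradient of \<open>objective n k A\<close> for the metric \<open>Tr (G\<^sub>1\<^sup>T G\<^sub>2)\<close>, as a tangent vector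
  with respect to the representative \<open>X\<close>: the projection of \<open>- 2 A X\<close> onto \<open>X\<^sup>T G = 0\<close>.
\<close>

definition rgrad :: "nat \<Rightarrow> real mat \<Rightarrow> real mat \<Rightarrow> real mat" where
  "rgrad n A X = (- 2) \<cdot>\<^sub>m ((1\<^sub>m n - X * X\<^sup>T) * A * X)"

text \<open>
  The representative of the current iterate may be chosen arbitrarily at each step; the next
  subspace does not depend on it.
\<close>

definition steepest_descent ::
    "nat \<Rightarrow> nat \<Rightarrow> real mat \<Rightarrow> real \<Rightarrow> (nat \<Rightarrow> real vec set) \<Rightarrow> bool" where
  "steepest_descent n k A \<eta> \<X> \<longleftrightarrow>
     (\<forall>t. \<exists>X. represents n k X (\<X> t) \<and> \<X> (Suc t) = gr_exp n k X ((- \<eta>) \<cdot>\<^sub>m rgrad n A X))"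

end

theory Submission
  imports Defs "HOL-Analysis.Convex" "HOL-Analysis.Function_Topology"
begin

text \<open>
  The proof follows the defect \<open>g(\<X>) = \<Sum> sin\<^sup>2 \<theta>\<^sub>i\<close> of the principal angles between \<open>\<X>\<close> and the leading
  eigenspace \<open>\<V>\<close>, which for a representative \<open>X\<close> is the squared norm of the component of \<open>X\<close> along
  \<open>v\<^sub>k\<^sub>+\<^sub>1, \<dots>, v\<^sub>n\<close>. It is comparable to the squared distance: \<open>g \<le> dist\<^sup>2 \<le> 4 g\<close>
  (\<open>gr_dist_bounds\<close>). Since \<open>\<epsilon>\<^sub>0\<close> may depend on \<open>A\<close> and \<open>\<X>\<^sub>0\<close>, multiplicative constants inside the
  logarithm are harmless, and the theorem reduces to two facts: every step multiplies \<open>g\<close> by at most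
  \<open>1 - c \<delta> / \<gamma>\<close> with an absolute constant \<open>c > 0\<close> (\<open>defect_step\<close>), and \<open>f(\<X>\<^sub>0) - f\<^sup>* \<ge> \<delta> g(\<X>\<^sub>0) > 0\<close>,
  so that the logarithm tends to infinity as \<open>\<epsilon>\<close> tends to 0 (\<open>objective_gap_ge\<close>,
  \<open>subspace_eq_leading_space\<close>).

  The contraction is an explicit computation along the geodesic. Put \<open>L = \<lambda>\<^sub>1 - \<lambda>\<^sub>n\<close>, let \<open>\<Pi> = X X\<^sup>T\<close>, and
  let \<open>y\<^sub>a\<close> and \<open>u\<^sub>a\<close> be the columns of \<open>X V\<close> and \<open>U\<close>, where \<open>U \<Sigma> V\<^sup>T\<close> is the singular value decomposition of
  the step; the new subspace is spanned by the vectors \<open>cos s\<^sub>a y\<^sub>a + sin s\<^sub>a u\<^sub>a\<close>, and the step size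
  \<open>1 / \<gamma>\<close> gives \<open>s\<^sub>a \<le> 1/2\<close>. In the coordinates of the eigenbasis everything is controlled by the single
  quantity \<open>D = \<Sum> (\<lambda>\<^sub>j - \<lambda>\<^sub>p) \<Pi>\<^sub>p\<^sub>j\<^sup>2\<close>, summed over \<open>j \<le> k < p\<close>:

  \<^item> the first-order change of \<open>g\<close> is exactly \<open>- 2 D / L\<close> (\<open>first_variation\<close>);
  \<^item> the second-order change is at most \<open>D / L\<close> (\<open>second_variation\<close>, \<open>grad_block_norm\<close>);
  \<^item> the error of replacing sines by their arguments is at most \<open>(0.32 + g / 12) \<Sum> s\<^sub>a\<^sup>2\<close>, and
    \<open>\<Sum> s\<^sub>a\<^sup>2 \<le> D / ((1 - g) L)\<close> (\<open>grad_norm\<close>);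
  \<^item> \<open>D \<ge> \<delta> (1 - g) g\<close> (\<open>coupling_ge\<close>).

  For \<open>g \<le> 5/8\<close> the error is at most \<open>199/200\<close> of \<open>D / L\<close>, so \<open>g\<close> decreases by a fixed fraction of \<open>D / L\<close>.
  The hypothesis \<open>dist(\<X>\<^sub>0, \<V>) \<le> \<pi>/4\<close> enters as \<open>g(\<X>\<^sub>0) \<le> \<pi>\<^sup>2 / 16 < 5/8\<close>, and the decrease of \<open>g\<close> keeps
  all later iterates in this region.
\<close>

unbundle no inner_syntax

section \<open>Estimates for the sine\<close>

lemma sin_ge_cubic:
  assumes "0 \<le> (x::real)"
  shows "x - x ^ 3 / 6 \<le> sin x"
proof -
  have "{..<3::nat} = {0,1,2}" by auto
  then have "(\<Sum>m<3. sin_coeff m * x ^ m) = x"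
    by (simp add: sin_coeff_def)
  then have "\<bar>sin x - x\<bar> \<le> x ^ 3 / 6"
    using Maclaurin_sin_bound[of x 3] assms by (simp add: fact_numeral)
  then show ?thesis by linarith
qed

text \<open>
  With \<open>x = 2 s\<close>, \<open>s \<le> 1/2\<close>, this bounds the deviation of \<open>sin 2s\<close> from \<open>2s\<close> along a step. The true maximum of
  \<open>(x - sin x) / x\<^sup>2\<close> on \<open>[0, 1]\<close> is about 0.1585; the value \<open>1/6\<close> from the cubic Taylor polynomial would be
  too large for the region of small defect to contain every starting point at distance \<open>\<pi>/4\<close>.
\<close>

lemma sin_ge_quadratic:
  assumes "0 \<le> (x::real)" "x \<le> 1"
  shows "x - sin x \<le> 16 / 100 * x\<^sup>2"
proof -
  have "{..<7::nat} = {0,1,2,3,4,5,6}" by auto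
  then have s: "(\<Sum>m<7. sin_coeff m * x ^ m) = x - x ^ 3 / 6 + x ^ 5 / 120"
    by (simp add: sin_coeff_def fact_numeral)
  have 1: "x - sin x \<le> x ^ 3 / 6 - x ^ 5 / 120 + x ^ 7 / 5040"
  proof -
    have "inverse (fact 7) * \<bar>x\<bar> ^ 7 = x ^ 7 / 5040"
      using assms by (simp add: fact_numeral)
    then show ?thesis
      using Maclaurin_sin_bound[of x 7] unfolding s by linarith
  qed
  have x5: "x ^ 5 \<le> x"
    using assms power_decreasing[of 1 5 x] by simp
  \<comment> \<open>The tangent line of the cube at 1 reduces the remaining estimate to a linear one.\<close>
  have "0 \<le> (x - 1)\<^sup>2 * (x + 2)" using assms by simp
  then have x3: "3 * x - 2 \<le> x ^ 3" by (simp add: power2_eq_square power3_eq_cube algebra_simps)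
  have "x / 6 - x ^ 3 / 120 + x ^ 5 / 5040 \<le> 16 / 100"
    using x5 x3 assms by linarith
  then have "x\<^sup>2 * (x / 6 - x ^ 3 / 120 + x ^ 5 / 5040) \<le> x\<^sup>2 * (16 / 100)"
    by (rule mult_left_mono) simp
  then have "x ^ 3 / 6 - x ^ 5 / 120 + x ^ 7 / 5040 \<le> 16 / 100 * x\<^sup>2"
    by (simp add: algebra_simps flip: power_add) (simp add: power2_eq_square power3_eq_cube eval_nat_numeral)
  with 1 show ?thesis by linarith
qed

lemma sin_squared_ge:
  assumes "0 \<le> (x::real)" "x \<le> 1 / 2"
  shows "x\<^sup>2 - (sin x)\<^sup>2 \<le> x\<^sup>2 / 12"
proof -
  have x2: "x\<^sup>2 \<le> 1 / 4" using power_mono[of x "1/2" 2] assms by (simp add: power2_eq_square)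
  have "0 \<le> x * (1 - x\<^sup>2 / 6)" using assms x2 by (intro mult_nonneg_nonneg) auto
  then have "0 \<le> x - x ^ 3 / 6" by (simp add: power2_eq_square power3_eq_cube algebra_simps)
  then have "(x - x ^ 3 / 6)\<^sup>2 \<le> (sin x)\<^sup>2"
    by (rule power_mono[OF sin_ge_cubic[OF assms(1)]])
  moreover have "(x - x ^ 3 / 6)\<^sup>2 = x\<^sup>2 - x\<^sup>2 * x\<^sup>2 / 3 + (x ^ 3 / 6)\<^sup>2"
    by (simp add: power2_eq_square power3_eq_cube algebra_simps)
  moreover have "x\<^sup>2 * x\<^sup>2 \<le> x\<^sup>2 * (1 / 4)" by (rule mult_left_mono[OF x2]) simp
  moreover have "0 \<le> (x ^ 3 / 6)\<^sup>2" by simp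
  ultimately show ?thesis by linarith
qed

lemma angle_le_sin:
  assumes "0 \<le> (x::real)" "x \<le> pi / 2"
  shows "x\<^sup>2 \<le> 4 * (sin x)\<^sup>2"
proof -
  define h where "h = x / 2"
  have h: "0 \<le> h" "h \<le> 1" using assms pi_half_less_two unfolding h_def by linarith+
  have "h\<^sup>2 \<le> 1" using power_mono[of h 1 2] h by simp
  then have "h * h\<^sup>2 \<le> h * 1" using h by (intro mult_left_mono) auto
  then have "5 / 6 * h \<le> sin h"
    using sin_ge_cubic[OF h(1)] by (simp add: power2_eq_square power3_eq_cube)
  then have "(5 / 6 * h)\<^sup>2 \<le> (sin h)\<^sup>2" using h by (intro power_mono) auto
  moreover have "cos x = 1 - 2 * (sin h)\<^sup>2" using cos_double_sin[of h] by (simp add: h_def)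
  moreover have "0 \<le> cos x" using assms by (intro cos_ge_zero) auto
  moreover have "1 - cos x \<le> (sin x)\<^sup>2"
  proof -
    have "0 \<le> cos x * (1 - cos x)" using \<open>0 \<le> cos x\<close> by simp
    then show ?thesis using sin_cos_squared_add[of x] unfolding power2_eq_square right_diff_distrib by linarith
  qed
  ultimately have "x\<^sup>2 * (25 / 72) \<le> (sin x)\<^sup>2" by (simp add: h_def power_divide power_mult_distrib)
  moreover have "0 \<le> (sin x)\<^sup>2" by simp
  ultimately show ?thesis by linarith
qed

text \<open>
  This inequality says \<open>\<pi>\<^sup>2 \<le> 10\<close>; it follows from \<open>sin (\<pi>/6) = 1/2\<close> and the cubic lower bound at \<open>79/150\<close>.
\<close>

lemma pi_squared_le: "(pi / 4)\<^sup>2 \<le> 5 / 8"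
proof -
  define a :: real where "a = 79 / 150"
  have "1 / 2 \<le> a - a ^ 3 / 6" by (simp add: a_def power3_eq_cube)
  also have "\<dots> \<le> sin a" by (rule sin_ge_cubic) (simp add: a_def)
  finally have "sin (pi / 6) \<le> sin a" by (simp add: sin_30)
  moreover have "a \<le> pi / 2" using pi_ge_two by (simp add: a_def)
  ultimately have "pi / 6 \<le> a"
    using pi_ge_two by (subst (asm) sin_mono_le_eq) (auto simp: a_def)
  then have "(pi / 4)\<^sup>2 \<le> (79 / 100)\<^sup>2" by (intro power_mono) (auto simp: a_def)
  then show ?thesis by (simp add: power2_eq_square)
qed

section \<open>Orthogonal projections in coordinates\<close>

text \<open>
  The vectors \<open>y a\<close> are functions on a finite index set, namely coordinate vectors with respect to an
  orthonormal basis; \<open>proj\<close> and \<open>coproj\<close> below are the matrix entries of the orthogonal projections onto their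
  span and onto its orthogonal complement.
\<close>

locale orthonormal_family =
  fixes I :: "'i set" and K :: "'a set" and y :: "'a \<Rightarrow> 'i \<Rightarrow> real"
  assumes finite_I: "finite I" and finite_K: "finite K"
    and orthonormal: "\<And>a b. a \<in> K \<Longrightarrow> b \<in> K \<Longrightarrow> (\<Sum>q\<in>I. y a q * y b q) = (if a = b then 1 else 0)"
begin

definition proj :: "'i \<Rightarrow> 'i \<Rightarrow> real" where
  "proj p q = (\<Sum>a\<in>K. y a p * y a q)"

lemma proj_sym: "proj p q = proj q p"
  unfolding proj_def by (simp add: mult.commute)

lemma inner_combination: "(\<Sum>q\<in>S. (\<Sum>a\<in>K. c a * y a q) * f q) = (\<Sum>a\<in>K. c a * (\<Sum>q\<in>S. y a q * f q))"
  by (simp add: sum_distrib_left sum_distrib_right mult.assoc sum.swap[of _ K])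

lemma inner_basis_combination:
  assumes "a \<in> K"
  shows "(\<Sum>q\<in>I. y a q * (\<Sum>b\<in>K. c b * y b q)) = c a"
proof -
  have "(\<Sum>q\<in>I. y a q * (\<Sum>b\<in>K. c b * y b q)) = (\<Sum>b\<in>K. c b * (\<Sum>q\<in>I. y b q * y a q))"
    using inner_combination[of c "y a" I] by (simp add: mult.commute)
  also have "\<dots> = (\<Sum>b\<in>K. if b = a then c b else 0)"
    by (rule sum.cong) (use assms orthonormal in auto)
  finally show ?thesis using assms finite_K by simp
qed

lemma sum_square_combination:
  "(\<Sum>q\<in>I. (\<Sum>a\<in>K. c a * y a q)\<^sup>2) = (\<Sum>a\<in>K. (c a)\<^sup>2)"
proof -
  have "(\<Sum>q\<in>I. (\<Sum>a\<in>K. c a * y a q)\<^sup>2)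
      = (\<Sum>a\<in>K. c a * (\<Sum>q\<in>I. y a q * (\<Sum>b\<in>K. c b * y b q)))"
    unfolding power2_eq_square by (rule inner_combination)
  also have "\<dots> = (\<Sum>a\<in>K. (c a)\<^sup>2)"
    by (rule sum.cong) (simp_all add: inner_basis_combination power2_eq_square)
  finally show ?thesis .
qed

lemma proj_apply: "(\<Sum>r\<in>S. proj q r * f r) = (\<Sum>a\<in>K. (\<Sum>r\<in>S. y a r * f r) * y a q)"
  unfolding proj_def
  by (simp add: sum_distrib_left sum_distrib_right mult_ac sum.swap[of _ K])

text \<open>
  Pythagoras. Bessel's inequality and the contractivity of both projections are read off from it.
\<close>

lemma residual_norm:
  "(\<Sum>q\<in>I. (f q - (\<Sum>r\<in>I. proj q r * f r))\<^sup>2) = (\<Sum>q\<in>I. (f q)\<^sup>2) - (\<Sum>a\<in>K. (\<Sum>q\<in>I. y a q * f q)\<^sup>2)"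
proof -
  define c where "c a = (\<Sum>r\<in>I. y a r * f r)" for a
  have "(\<Sum>q\<in>I. (f q - (\<Sum>r\<in>I. proj q r * f r))\<^sup>2)
     = (\<Sum>q\<in>I. (f q)\<^sup>2 - 2 * ((\<Sum>a\<in>K. c a * y a q) * f q) + (\<Sum>a\<in>K. c a * y a q)\<^sup>2)"
    by (intro sum.cong refl) (simp add: proj_apply c_def power2_diff)
  also have "\<dots> = (\<Sum>q\<in>I. (f q)\<^sup>2) - 2 * (\<Sum>q\<in>I. (\<Sum>a\<in>K. c a * y a q) * f q) + (\<Sum>q\<in>I. (\<Sum>a\<in>K. c a * y a q)\<^sup>2)"
    by (simp add: sum.distrib sum_subtractf sum_distrib_left)
  also have "\<dots> = (\<Sum>q\<in>I. (f q)\<^sup>2) - (\<Sum>a\<in>K. (c a)\<^sup>2)"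
    unfolding inner_combination sum_square_combination c_def[symmetric]
    by (simp add: power2_eq_square)
  finally show ?thesis by (simp add: c_def)
qed

lemma bessel: "(\<Sum>a\<in>K. (\<Sum>q\<in>I. y a q * f q)\<^sup>2) \<le> (\<Sum>q\<in>I. (f q)\<^sup>2)"
proof -
  have "0 \<le> (\<Sum>q\<in>I. (f q - (\<Sum>r\<in>I. proj q r * f r))\<^sup>2)"
    by (intro sum_nonneg) auto
  then show ?thesis unfolding residual_norm by linarith
qed

lemma residual_contraction:
  "(\<Sum>q\<in>I. (f q - (\<Sum>r\<in>I. proj q r * f r))\<^sup>2) \<le> (\<Sum>q\<in>I. (f q)\<^sup>2)"
  unfolding residual_norm using sum_nonneg[of K "\<lambda>a. (\<Sum>q\<in>I. y a q * f q)\<^sup>2"] by simp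

text \<open>
  Extending a vector by zero transfers the contraction estimates to the blocks of a projection.
\<close>

lemma sum_zero_extension:
  fixes f g :: "'i \<Rightarrow> real"
  assumes "S \<subseteq> I"
  shows "(\<Sum>q\<in>I. g q * (if q \<in> S then f q else 0)) = (\<Sum>q\<in>S. g q * f q)"
    "(\<Sum>q\<in>I. (if q \<in> S then f q else 0)\<^sup>2) = (\<Sum>q\<in>S. (f q)\<^sup>2)"
  by (rule sum.mono_neutral_cong_right, use assms finite_I in auto)+

lemma bessel_subset:
  assumes "S \<subseteq> I"
  shows "(\<Sum>a\<in>K. (\<Sum>q\<in>S. y a q * f q)\<^sup>2) \<le> (\<Sum>q\<in>S. (f q)\<^sup>2)"
  using bessel[of "\<lambda>q. if q \<in> S then f q else 0"]
  unfolding sum_zero_extension[OF assms] .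

lemma proj_contraction_subset:
  assumes "S \<subseteq> I"
  shows "(\<Sum>q\<in>I. (\<Sum>r\<in>S. proj q r * f r)\<^sup>2) \<le> (\<Sum>q\<in>S. (f q)\<^sup>2)"
  unfolding proj_apply sum_square_combination by (rule bessel_subset[OF assms])

lemma residual_contraction_subset:
  assumes "S \<subseteq> I"
  shows "(\<Sum>q\<in>I. ((if q \<in> S then f q else 0) - (\<Sum>r\<in>S. proj q r * f r))\<^sup>2) \<le> (\<Sum>q\<in>S. (f q)\<^sup>2)"
  using residual_contraction[of "\<lambda>q. if q \<in> S then f q else 0"]
  unfolding sum_zero_extension[OF assms] .

lemma proj_idem: "(\<Sum>r\<in>I. proj p r * proj r q) = proj p q"
proof -
  have "(\<Sum>r\<in>I. proj p r * proj r q) = (\<Sum>a\<in>K. (\<Sum>r\<in>I. y a r * (\<Sum>b\<in>K. y b q * y b r)) * y a p)"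
    unfolding proj_apply by (simp add: proj_def mult.commute)
  also have "\<dots> = (\<Sum>a\<in>K. y a q * y a p)"
    by (intro sum.cong refl) (simp add: inner_basis_combination)
  finally show ?thesis by (simp add: proj_def mult.commute)
qed

lemma proj_row_norm: "(\<Sum>r\<in>I. (proj p r)\<^sup>2) = proj p p"
proof -
  have "(proj p r)\<^sup>2 = proj p r * proj r p" for r
    using proj_sym[of r p] by (simp add: power2_eq_square)
  then show ?thesis using proj_idem[of p p] by simp
qed

lemma proj_diag_nonneg: "0 \<le> proj p p"
  unfolding proj_def by (intro sum_nonneg) auto

lemma sum_proj_diag: "(\<Sum>q\<in>S. proj q q) = (\<Sum>a\<in>K. \<Sum>q\<in>S. (y a q)\<^sup>2)"
  unfolding proj_def by (simp add: power2_eq_square sum.swap[of _ K])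

lemma proj_cauchy_schwarz: "(proj p q)\<^sup>2 \<le> proj p p * proj q q"
  unfolding proj_def using Cauchy_Schwarz_ineq_sum[of "\<lambda>a. y a p" "\<lambda>a. y a q" K]
  by (simp add: power2_eq_square)

definition coproj :: "'i \<Rightarrow> 'i \<Rightarrow> real" where
  "coproj p q = (if p = q then 1 else 0) - proj p q"

lemma coproj_sym: "coproj p q = coproj q p"
  unfolding coproj_def by (simp add: proj_sym)

lemma coproj_idem:
  assumes "p \<in> I" "q \<in> I"
  shows "(\<Sum>r\<in>I. coproj p r * coproj r q) = coproj p q"
proof -
  have "(\<Sum>r\<in>I. coproj p r * coproj r q)
      = (\<Sum>r\<in>I. (if p = r then (if r = q then 1 else 0) else 0) - (if p = r then proj r q else 0)
            - (if r = q then proj p r else 0) + proj p r * proj r q)"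
    by (intro sum.cong refl) (auto simp: coproj_def algebra_simps)
  then show ?thesis
    using assms finite_I by (simp add: sum.distrib sum_subtractf proj_idem coproj_def)
qed

lemma coproj_row_norm:
  assumes "p \<in> I"
  shows "(\<Sum>r\<in>I. (coproj p r)\<^sup>2) = coproj p p"
proof -
  have "(coproj p r)\<^sup>2 = coproj p r * coproj r p" for r
    using coproj_sym[of r p] by (simp add: power2_eq_square)
  then show ?thesis using coproj_idem[OF assms assms] by simp
qed

lemma coproj_diag_nonneg:
  assumes "p \<in> I"
  shows "0 \<le> coproj p p"
  unfolding coproj_row_norm[OF assms, symmetric] by (intro sum_nonneg) auto

lemma coproj_cauchy_schwarz:
  assumes "p \<in> I" "q \<in> I"
  shows "(coproj p q)\<^sup>2 \<le> coproj p p * coproj q q"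
proof -
  have "coproj p r * coproj q r = coproj p r * coproj r q" for r
    using coproj_sym[of r q] by simp
  then have "(\<Sum>r\<in>I. coproj p r * coproj q r) = coproj p q"
    using coproj_idem[OF assms] by (simp only:)
  then have "(coproj p q)\<^sup>2 = (\<Sum>r\<in>I. coproj p r * coproj q r)\<^sup>2"
    by simp
  also have "\<dots> \<le> (\<Sum>r\<in>I. (coproj p r)\<^sup>2) * (\<Sum>r\<in>I. (coproj q r)\<^sup>2)"
    by (rule Cauchy_Schwarz_ineq_sum)
  finally show ?thesis by (simp add: coproj_row_norm assms)
qed

end

text \<open>
  The weighted triangle inequality that combines the estimates above and below the spectral gap: with
  separate bounds \<open>l1 * d1\<close> and \<open>l2 * d2\<close> the cross term is at most \<open>l1 * d2 + l2 * d1\<close> by the inequality of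
  arithmetic and geometric means, so that no factor 2 is lost.
\<close>

lemma sum_square_add_le:
  fixes x z :: "'i \<Rightarrow> real"
  assumes "(\<Sum>i\<in>S. (x i)\<^sup>2) \<le> l1 * d1" "(\<Sum>i\<in>S. (z i)\<^sup>2) \<le> l2 * d2"
    "0 \<le> l1" "0 \<le> l2" "0 \<le> d1" "0 \<le> d2"
  shows "(\<Sum>i\<in>S. (x i + z i)\<^sup>2) \<le> (l1 + l2) * (d1 + d2)"
proof -
  define X Z where "X = (\<Sum>i\<in>S. (x i)\<^sup>2)" and "Z = (\<Sum>i\<in>S. (z i)\<^sup>2)"
  have XZ: "0 \<le> X" "0 \<le> Z" unfolding X_def Z_def by (auto intro: sum_nonneg)
  have "(\<Sum>i\<in>S. x i * z i)\<^sup>2 \<le> X * Z"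
    unfolding X_def Z_def by (rule Cauchy_Schwarz_ineq_sum)
  also have "\<dots> \<le> (l1 * d1) * (l2 * d2)"
    using assms XZ by (intro mult_mono) (auto simp: X_def Z_def)
  finally have "(2 * (\<Sum>i\<in>S. x i * z i))\<^sup>2 \<le> 4 * ((l1 * d2) * (l2 * d1))"
    by (simp add: power_mult_distrib mult_ac)
  also have "\<dots> \<le> (l1 * d2 + l2 * d1)\<^sup>2"
  proof -
    have "0 \<le> (l1 * d2 - l2 * d1)\<^sup>2" by simp
    then show ?thesis by (simp add: power2_eq_square algebra_simps)
  qed
  finally have "2 * (\<Sum>i\<in>S. x i * z i) \<le> l1 * d2 + l2 * d1"
    by (rule power2_le_imp_le) (use assms(3-6) in simp)
  moreover have "(\<Sum>i\<in>S. (x i + z i)\<^sup>2) = X + Z + 2 * (\<Sum>i\<in>S. x i * z i)"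
    unfolding X_def Z_def by (simp add: power2_sum sum.distrib sum_distrib_left mult.assoc)
  moreover have "X \<le> l1 * d1" "Z \<le> l2 * d2" using assms(1,2) by (simp_all add: X_def Z_def)
  ultimately show ?thesis by (simp add: distrib_left distrib_right)
qed

section \<open>The defect along one geodesic step\<close>

text \<open>
  The index set of the eigenbasis splits into \<open>J\<close> (eigenvalues above the gap) and \<open>Q\<close> (below it). The numbers
  \<open>\<mu> q\<close> are the eigenvalues shifted by \<open>\<lambda>\<^sub>k\<close>; the shift makes them nonnegative on \<open>J\<close> and at most \<open>-\<delta>\<close> on
  \<open>Q\<close>, and it changes neither the gradient nor differences of eigenvalues.
\<close>

locale gap_splitting = orthonormal_family "J \<union> Q" K y
  for J Q :: "'i set" and K :: "'a set" and y :: "'a \<Rightarrow> 'i \<Rightarrow> real" +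
  fixes \<mu> :: "'i \<Rightarrow> real" and l1 l2 :: real and \<delta> :: real
  assumes disjoint: "J \<inter> Q = {}" and card_J: "card J = card K"
    and upper: "\<And>j. j \<in> J \<Longrightarrow> 0 \<le> \<mu> j \<and> \<mu> j \<le> l1"
    and lower: "\<And>p. p \<in> Q \<Longrightarrow> - l2 \<le> \<mu> p \<and> \<mu> p \<le> - \<delta>"
    and bounds_nonneg: "0 \<le> l1" "0 \<le> l2" "0 \<le> \<delta>"
begin

definition defect :: real where
  "defect = (\<Sum>p\<in>Q. proj p p)"

text \<open>
  The quantity \<open>D\<close> that controls a step. It equals \<open>Tr (P (I - \<Pi>) A \<Pi>)\<close>, where \<open>P\<close> projects onto the leading
  eigenspace, and splits into two nonnegative parts that are estimated separately.
\<close>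

definition coupling :: real where
  "coupling = (\<Sum>p\<in>Q. \<Sum>j\<in>J. (\<mu> j - \<mu> p) * (proj p j)\<^sup>2)"

definition upper_coupling :: real where
  "upper_coupling = (\<Sum>p\<in>Q. \<Sum>j\<in>J. \<mu> j * (proj p j)\<^sup>2)"

definition lower_coupling :: real where
  "lower_coupling = (\<Sum>p\<in>Q. \<Sum>j\<in>J. - \<mu> p * (proj p j)\<^sup>2)"

text \<open>
  For diagonal \<open>A\<close> with entries \<open>\<mu>\<close>, \<open>grad a\<close> is \<open>(I - \<Pi>) A y\<^sub>a\<close>, which is \<open>L\<close> times a column of the step, and \<open>gradmat\<close> is the matrix \<open>(I - \<Pi>) A \<Pi>\<close>.
\<close>

definition grad :: "'a \<Rightarrow> 'i \<Rightarrow> real" where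
  "grad a q = \<mu> q * y a q - (\<Sum>r\<in>J \<union> Q. proj q r * (\<mu> r * y a r))"

definition gradmat :: "'i \<Rightarrow> 'i \<Rightarrow> real" where
  "gradmat p q = \<mu> p * proj p q - (\<Sum>r\<in>J \<union> Q. proj p r * (\<mu> r * proj r q))"

lemma finite_J: "finite J" and finite_Q: "finite Q"
  using finite_I by auto

lemma sum_J_Q: "(\<Sum>q\<in>J \<union> Q. f q) = (\<Sum>q\<in>J. f q) + (\<Sum>q\<in>Q. f q)" for f :: "'i \<Rightarrow> real"
  using finite_J finite_Q disjoint by (rule sum.union_disjoint)

lemma coupling_eq: "coupling = upper_coupling + lower_coupling"
  unfolding coupling_def upper_coupling_def lower_coupling_def
  by (simp add: left_diff_distrib sum_subtractf sum_negf)

lemma upper_coupling_nonneg: "0 \<le> upper_coupling"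
  unfolding upper_coupling_def using upper by (intro sum_nonneg mult_nonneg_nonneg) auto

lemma lower_coupling_nonneg: "0 \<le> lower_coupling"
  unfolding lower_coupling_def
  by (intro sum_nonneg mult_nonneg_nonneg) (use lower bounds_nonneg in force)+

lemma defect_nonneg: "0 \<le> defect"
  unfolding defect_def by (intro sum_nonneg proj_diag_nonneg)

lemma defect_eq: "defect = (\<Sum>a\<in>K. \<Sum>p\<in>Q. (y a p)\<^sup>2)"
  unfolding defect_def by (rule sum_proj_diag)

lemma trace_proj: "(\<Sum>q\<in>J \<union> Q. proj q q) = real (card K)"
  unfolding sum_proj_diag using orthonormal by (simp add: power2_eq_square)

text \<open>
  Both blocks carry the same defect because \<open>J\<close> has as many elements as the family \<open>y\<close>.
\<close>

lemma defect_eq_coproj: "defect = (\<Sum>j\<in>J. coproj j j)"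
  using trace_proj unfolding sum_J_Q defect_def coproj_def
  by (simp add: sum_subtractf card_J)

text \<open>
  A column of \<open>\<Pi>\<close> with index in \<open>Q\<close> is a vector of the range of \<open>\<Pi>\<close>, and on this range the projection to the
  coordinates in \<open>Q\<close> has squared Frobenius norm \<open>defect\<close>; hence most of the column lies in \<open>J\<close>.
\<close>

lemma proj_row_J_ge:
  assumes "p \<in> Q"
  shows "(1 - defect) * proj p p \<le> (\<Sum>j\<in>J. (proj p j)\<^sup>2)"
proof -
  have "(\<Sum>q\<in>Q. (proj p q)\<^sup>2) \<le> (\<Sum>q\<in>Q. proj p p * proj q q)"
    by (intro sum_mono proj_cauchy_schwarz)
  then have "(\<Sum>q\<in>Q. (proj p q)\<^sup>2) \<le> proj p p * defect"
    by (simp add: defect_def sum_distrib_left)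
  then show ?thesis
    using proj_row_norm[of p] unfolding sum_J_Q by (simp add: algebra_simps)
qed

lemma coproj_off_diagonal: "j \<in> J \<Longrightarrow> p \<in> Q \<Longrightarrow> coproj j p = - proj p j"
  using disjoint unfolding coproj_def by (auto simp: proj_sym[of j])

text \<open>
  The mirror image of \<open>proj_row_J_ge\<close> for the complementary projection.
\<close>

lemma proj_column_Q_ge:
  assumes "j \<in> J"
  shows "(1 - defect) * coproj j j \<le> (\<Sum>p\<in>Q. (proj p j)\<^sup>2)"
proof -
  have "(\<Sum>q\<in>J. (coproj j q)\<^sup>2) \<le> (\<Sum>q\<in>J. coproj j j * coproj q q)"
    using assms by (intro sum_mono coproj_cauchy_schwarz) auto
  then have "(\<Sum>q\<in>J. (coproj j q)\<^sup>2) \<le> coproj j j * defect"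
    by (simp add: defect_eq_coproj sum_distrib_left)
  moreover have "(\<Sum>q\<in>Q. (coproj j q)\<^sup>2) = (\<Sum>p\<in>Q. (proj p j)\<^sup>2)"
    using assms by (intro sum.cong refl) (simp add: coproj_off_diagonal)
  ultimately show ?thesis
    using coproj_row_norm[of j] assms unfolding sum_J_Q by (simp add: algebra_simps)
qed

lemma upper_square: "j \<in> J \<Longrightarrow> 0 \<le> x \<Longrightarrow> (\<mu> j)\<^sup>2 * x \<le> l1 * (\<mu> j * x)"
  using upper[of j] by (simp add: power2_eq_square mult.assoc mult_right_mono)

lemma lower_square:
  assumes "p \<in> Q" "0 \<le> x"
  shows "(\<mu> p)\<^sup>2 * x \<le> l2 * (- \<mu> p * x)"
proof -
  have "(- \<mu> p) * (- \<mu> p * x) \<le> l2 * (- \<mu> p * x)"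
    using lower[OF assms(1)] bounds_nonneg assms(2)
    by (intro mult_right_mono mult_nonneg_nonneg) linarith+
  then show ?thesis by (simp add: power2_eq_square mult.assoc)
qed

text \<open>
  The block of \<open>(I - \<Pi>) A \<Pi>\<close> with rows in \<open>Q\<close> and columns in \<open>J\<close> is the block of \<open>\<Pi>\<close> with its columns
  weighted by \<open>\<mu>\<close> and then contracted by a block of \<open>\<Pi>\<close>, plus the same block with its rows weighted and contracted
  by a block of \<open>I - \<Pi>\<close>. This keeps the constant 1, whereas the norm of the full gradient
  costs a factor \<open>1 / (1 - defect)\<close>.
\<close>

lemma grad_block_norm:
  "(\<Sum>p\<in>Q. \<Sum>j\<in>J. (gradmat p j)\<^sup>2) \<le> (l1 + l2) * coupling"
proof -
  define x z where "x = (\<lambda>(p, j). - (\<Sum>r\<in>J. proj p r * (\<mu> r * proj r j)))"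
    and "z = (\<lambda>(p, j). \<mu> p * proj p j - (\<Sum>r\<in>Q. proj p r * (\<mu> r * proj r j)))"
  have "(\<Sum>pj\<in>Q \<times> J. (x pj)\<^sup>2) = (\<Sum>p\<in>Q. \<Sum>j\<in>J. (\<Sum>r\<in>J. proj j r * (\<mu> r * proj p r))\<^sup>2)"
    unfolding sum.cartesian_product
  proof (intro sum.cong refl)
    fix pj assume "pj \<in> Q \<times> J"
    obtain p j where pj: "pj = (p, j)" by fastforce
    have "proj p r * (\<mu> r * proj r j) = proj j r * (\<mu> r * proj p r)" for r
      using proj_sym[of r j] by simp
    then show "(x pj)\<^sup>2 = (case pj of (p, j) \<Rightarrow> (\<Sum>r\<in>J. proj j r * (\<mu> r * proj p r))\<^sup>2)"
      by (simp only: x_def pj prod.case power2_minus)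
  qed
  also have "\<dots> \<le> (\<Sum>p\<in>Q. \<Sum>r\<in>J. (\<mu> r * proj p r)\<^sup>2)"
  proof (rule sum_mono)
    fix p
    have "(\<Sum>j\<in>J. (\<Sum>r\<in>J. proj j r * (\<mu> r * proj p r))\<^sup>2)
        \<le> (\<Sum>j\<in>J \<union> Q. (\<Sum>r\<in>J. proj j r * (\<mu> r * proj p r))\<^sup>2)"
      using finite_I by (intro sum_mono2) auto
    also have "\<dots> \<le> (\<Sum>r\<in>J. (\<mu> r * proj p r)\<^sup>2)"
      by (rule proj_contraction_subset) auto
    finally show "(\<Sum>j\<in>J. (\<Sum>r\<in>J. proj j r * (\<mu> r * proj p r))\<^sup>2) \<le> (\<Sum>r\<in>J. (\<mu> r * proj p r)\<^sup>2)" .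
  qed
  also have "\<dots> \<le> (\<Sum>p\<in>Q. \<Sum>r\<in>J. l1 * (\<mu> r * (proj p r)\<^sup>2))"
    unfolding power_mult_distrib by (intro sum_mono upper_square) auto
  also have "\<dots> = l1 * upper_coupling"
    by (simp add: upper_coupling_def sum_distrib_left)
  finally have x: "(\<Sum>pj\<in>Q \<times> J. (x pj)\<^sup>2) \<le> l1 * upper_coupling" .
  have "(\<Sum>pj\<in>Q \<times> J. (z pj)\<^sup>2)
      = (\<Sum>p\<in>Q. \<Sum>j\<in>J. (\<mu> p * proj p j - (\<Sum>r\<in>Q. proj p r * (\<mu> r * proj r j)))\<^sup>2)"
    unfolding z_def sum.cartesian_product by (intro sum.cong refl) auto
  also have "\<dots> = (\<Sum>j\<in>J. \<Sum>p\<in>Q. (\<mu> p * proj p j - (\<Sum>r\<in>Q. proj p r * (\<mu> r * proj r j)))\<^sup>2)"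
    by (rule sum.swap)
  also have "\<dots> \<le> (\<Sum>j\<in>J. \<Sum>r\<in>Q. (\<mu> r * proj r j)\<^sup>2)"
  proof (rule sum_mono)
    fix j
    have "(\<Sum>p\<in>Q. (\<mu> p * proj p j - (\<Sum>r\<in>Q. proj p r * (\<mu> r * proj r j)))\<^sup>2)
        = (\<Sum>p\<in>Q. ((if p \<in> Q then \<mu> p * proj p j else 0) - (\<Sum>r\<in>Q. proj p r * (\<mu> r * proj r j)))\<^sup>2)"
      by simp
    also have "\<dots> \<le> (\<Sum>p\<in>J \<union> Q. ((if p \<in> Q then \<mu> p * proj p j else 0) - (\<Sum>r\<in>Q. proj p r * (\<mu> r * proj r j)))\<^sup>2)"
      using finite_I by (intro sum_mono2) auto
    also have "\<dots> \<le> (\<Sum>r\<in>Q. (\<mu> r * proj r j)\<^sup>2)"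
      by (rule residual_contraction_subset) auto
    finally show "(\<Sum>p\<in>Q. (\<mu> p * proj p j - (\<Sum>r\<in>Q. proj p r * (\<mu> r * proj r j)))\<^sup>2)
        \<le> (\<Sum>r\<in>Q. (\<mu> r * proj r j)\<^sup>2)" .
  qed
  also have "\<dots> = (\<Sum>r\<in>Q. \<Sum>j\<in>J. (\<mu> r * proj r j)\<^sup>2)"
    by (rule sum.swap)
  also have "\<dots> \<le> (\<Sum>r\<in>Q. \<Sum>j\<in>J. l2 * (- \<mu> r * (proj r j)\<^sup>2))"
    unfolding power_mult_distrib by (intro sum_mono lower_square) auto
  also have "\<dots> = l2 * lower_coupling"
    unfolding lower_coupling_def sum_distrib_left ..
  finally have z: "(\<Sum>pj\<in>Q \<times> J. (z pj)\<^sup>2) \<le> l2 * lower_coupling" .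
  have "(\<Sum>p\<in>Q. \<Sum>j\<in>J. (gradmat p j)\<^sup>2) = (\<Sum>pj\<in>Q \<times> J. (x pj + z pj)\<^sup>2)"
    unfolding x_def z_def gradmat_def sum.cartesian_product sum_J_Q
    by (intro sum.cong refl) (auto simp: algebra_simps)
  also have "\<dots> \<le> (l1 + l2) * coupling"
    unfolding coupling_eq using x z bounds_nonneg upper_coupling_nonneg lower_coupling_nonneg
    by (intro sum_square_add_le) auto
  finally show ?thesis .
qed

text \<open>
  The contributions of \<open>J\<close> and \<open>Q\<close> to the gradient are controlled by the diagonals of \<open>I - \<Pi>\<close> and \<open>\<Pi>\<close>. Passing
  from these to the off-diagonal block that defines \<open>coupling\<close> loses the factor \<open>1 - defect\<close>.
\<close>

lemma grad_norm:
  assumes "defect \<le> 1"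
  shows "(1 - defect) * (\<Sum>a\<in>K. \<Sum>q\<in>J \<union> Q. (grad a q)\<^sup>2) \<le> (l1 + l2) * coupling"
proof -
  define x z where "x = (\<lambda>(a, q). (if q \<in> J then \<mu> q * y a q else 0) - (\<Sum>r\<in>J. proj q r * (\<mu> r * y a r)))"
    and "z = (\<lambda>(a, q). (if q \<in> Q then \<mu> q * y a q else 0) - (\<Sum>r\<in>Q. proj q r * (\<mu> r * y a r)))"
  define d1 d2 where "d1 = (\<Sum>j\<in>J. \<mu> j * coproj j j)" and "d2 = (\<Sum>p\<in>Q. - \<mu> p * proj p p)"
  have coproj_comb: "x (a, q) = (\<Sum>r\<in>J. y a r * (coproj q r * \<mu> r))" if "q \<in> J \<union> Q" for a q
  proof -
    have "(\<Sum>r\<in>J. y a r * (coproj q r * \<mu> r))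
      = (\<Sum>r\<in>J. (if q = r then \<mu> r * y a r else 0) - proj q r * (\<mu> r * y a r))"
      by (intro sum.cong refl) (auto simp: coproj_def algebra_simps)
    then show ?thesis using finite_J by (simp add: x_def sum_subtractf)
  qed
  have "(\<Sum>aq\<in>K \<times> (J \<union> Q). (x aq)\<^sup>2) = (\<Sum>a\<in>K. \<Sum>q\<in>J \<union> Q. (\<Sum>r\<in>J. y a r * (coproj q r * \<mu> r))\<^sup>2)"
    unfolding sum.cartesian_product by (intro sum.cong refl) (auto simp: coproj_comb)
  also have "\<dots> = (\<Sum>q\<in>J \<union> Q. \<Sum>a\<in>K. (\<Sum>r\<in>J. y a r * (coproj q r * \<mu> r))\<^sup>2)"
    by (rule sum.swap)
  also have "\<dots> \<le> (\<Sum>q\<in>J \<union> Q. \<Sum>r\<in>J. (coproj q r * \<mu> r)\<^sup>2)"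
    by (intro sum_mono bessel_subset) auto
  also have "\<dots> = (\<Sum>r\<in>J. \<Sum>q\<in>J \<union> Q. (coproj q r * \<mu> r)\<^sup>2)"
    by (rule sum.swap)
  also have "\<dots> = (\<Sum>r\<in>J. (\<mu> r)\<^sup>2 * coproj r r)"
  proof (intro sum.cong refl)
    fix r assume "r \<in> J"
    then have "(\<Sum>q\<in>J \<union> Q. (coproj r q)\<^sup>2) = coproj r r" by (intro coproj_row_norm) auto
    moreover have "(\<Sum>q\<in>J \<union> Q. (coproj q r * \<mu> r)\<^sup>2) = (\<mu> r)\<^sup>2 * (\<Sum>q\<in>J \<union> Q. (coproj r q)\<^sup>2)"
      unfolding sum_distrib_left
      by (intro sum.cong refl) (simp add: power_mult_distrib coproj_sym[of _ r])
    ultimately show "(\<Sum>q\<in>J \<union> Q. (coproj q r * \<mu> r)\<^sup>2) = (\<mu> r)\<^sup>2 * coproj r r" by (simp only:)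
  qed
  also have "\<dots> \<le> (\<Sum>r\<in>J. l1 * (\<mu> r * coproj r r))"
    by (intro sum_mono upper_square coproj_diag_nonneg) auto
  also have "\<dots> = l1 * d1" by (simp add: d1_def sum_distrib_left)
  finally have x: "(\<Sum>aq\<in>K \<times> (J \<union> Q). (x aq)\<^sup>2) \<le> l1 * d1" .
  have "(\<Sum>aq\<in>K \<times> (J \<union> Q). (z aq)\<^sup>2)
      = (\<Sum>a\<in>K. \<Sum>q\<in>J \<union> Q. ((if q \<in> Q then \<mu> q * y a q else 0) - (\<Sum>r\<in>Q. proj q r * (\<mu> r * y a r)))\<^sup>2)"
    unfolding z_def sum.cartesian_product by (intro sum.cong refl) auto
  also have "\<dots> \<le> (\<Sum>a\<in>K. \<Sum>r\<in>Q. (\<mu> r * y a r)\<^sup>2)"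
    by (intro sum_mono residual_contraction_subset) auto
  also have "\<dots> = (\<Sum>r\<in>Q. \<Sum>a\<in>K. (\<mu> r * y a r)\<^sup>2)"
    by (rule sum.swap)
  also have "\<dots> = (\<Sum>r\<in>Q. (\<mu> r)\<^sup>2 * proj r r)"
    by (simp add: proj_def sum_distrib_left power2_eq_square mult_ac)
  also have "\<dots> \<le> (\<Sum>r\<in>Q. l2 * (- \<mu> r * proj r r))"
    by (intro sum_mono lower_square proj_diag_nonneg) auto
  also have "\<dots> = l2 * d2" unfolding d2_def sum_distrib_left ..
  finally have z: "(\<Sum>aq\<in>K \<times> (J \<union> Q). (z aq)\<^sup>2) \<le> l2 * d2" .
  have "(\<Sum>a\<in>K. \<Sum>q\<in>J \<union> Q. (grad a q)\<^sup>2) = (\<Sum>aq\<in>K \<times> (J \<union> Q). (x aq + z aq)\<^sup>2)"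
    unfolding sum.cartesian_product
  proof (intro sum.cong refl)
    fix aq assume "aq \<in> K \<times> (J \<union> Q)"
    then obtain a q where aq: "aq = (a, q)" "q \<in> J \<union> Q" by auto
    have "(if q \<in> J then \<mu> q * y a q else 0) + (if q \<in> Q then \<mu> q * y a q else 0) = \<mu> q * y a q"
      using aq disjoint by auto
    then have "grad a q = x (a, q) + z (a, q)"
      unfolding grad_def x_def z_def sum_J_Q by simp
    then show "(case aq of (a, q) \<Rightarrow> (grad a q)\<^sup>2) = (x aq + z aq)\<^sup>2" by (simp add: aq)
  qed
  also have "\<dots> \<le> (l1 + l2) * (d1 + d2)"
  proof (rule sum_square_add_le[OF x z])
    show "0 \<le> d1" unfolding d1_def
      using upper by (intro sum_nonneg mult_nonneg_nonneg coproj_diag_nonneg) auto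
    show "0 \<le> d2" unfolding d2_def
      by (intro sum_nonneg mult_nonneg_nonneg proj_diag_nonneg) (use lower bounds_nonneg in force)
  qed (use bounds_nonneg in auto)
  finally have "(1 - defect) * (\<Sum>a\<in>K. \<Sum>q\<in>J \<union> Q. (grad a q)\<^sup>2) \<le> (1 - defect) * ((l1 + l2) * (d1 + d2))"
    using assms by (intro mult_left_mono) auto
  also have "\<dots> = (l1 + l2) * ((1 - defect) * d1 + (1 - defect) * d2)"
    by (simp add: algebra_simps)
  also have "\<dots> \<le> (l1 + l2) * (upper_coupling + lower_coupling)"
  proof (intro mult_left_mono add_mono)
    have "(1 - defect) * d1 = (\<Sum>j\<in>J. \<mu> j * ((1 - defect) * coproj j j))"
      by (simp add: d1_def sum_distrib_left mult_ac)
    also have "\<dots> \<le> (\<Sum>j\<in>J. \<mu> j * (\<Sum>p\<in>Q. (proj p j)\<^sup>2))"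
      using upper by (intro sum_mono mult_left_mono proj_column_Q_ge) auto
    also have "\<dots> = upper_coupling"
      unfolding upper_coupling_def sum_distrib_left by (rule sum.swap)
    finally show "(1 - defect) * d1 \<le> upper_coupling" .
    have "(1 - defect) * d2 = (\<Sum>p\<in>Q. - \<mu> p * ((1 - defect) * proj p p))"
      unfolding d2_def sum_distrib_left by (intro sum.cong refl) (simp add: algebra_simps)
    also have "\<dots> \<le> (\<Sum>p\<in>Q. - \<mu> p * (\<Sum>j\<in>J. (proj p j)\<^sup>2))"
      by (intro sum_mono mult_left_mono proj_row_J_ge) (use lower bounds_nonneg in force)+
    also have "\<dots> = lower_coupling"
      unfolding lower_coupling_def sum_distrib_left ..
    finally show "(1 - defect) * d2 \<le> lower_coupling" .
  qed (use bounds_nonneg in auto)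
  finally show ?thesis by (simp add: coupling_eq)
qed

lemma coupling_ge:
  assumes "defect \<le> 1"
  shows "\<delta> * (1 - defect) * defect \<le> coupling"
proof -
  have "\<delta> * (1 - defect) * defect = (\<Sum>p\<in>Q. \<delta> * ((1 - defect) * proj p p))"
    unfolding sum_distrib_left[symmetric] by (simp add: defect_def)
  also have "\<dots> \<le> (\<Sum>p\<in>Q. \<delta> * (\<Sum>j\<in>J. (proj p j)\<^sup>2))"
    using bounds_nonneg by (intro sum_mono mult_left_mono proj_row_J_ge) auto
  also have "\<dots> \<le> coupling"
    unfolding coupling_def sum_distrib_left
    by (intro sum_mono mult_right_mono) (use upper lower in force)+
  finally show ?thesis .
qed

lemma gradmat_eq: "(\<Sum>a\<in>K. grad a p * y a q) = gradmat p q"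
proof -
  have "(\<Sum>a\<in>K. grad a p * y a q)
     = \<mu> p * proj p q - (\<Sum>a\<in>K. \<Sum>r\<in>J \<union> Q. proj p r * (\<mu> r * (y a r * y a q)))"
    unfolding grad_def left_diff_distrib sum_subtractf
    by (simp add: proj_def sum_distrib_left sum_distrib_right mult_ac)
  also have "(\<Sum>a\<in>K. \<Sum>r\<in>J \<union> Q. proj p r * (\<mu> r * (y a r * y a q)))
     = (\<Sum>r\<in>J \<union> Q. \<Sum>a\<in>K. proj p r * (\<mu> r * (y a r * y a q)))"
    by (rule sum.swap)
  also have "\<dots> = (\<Sum>r\<in>J \<union> Q. proj p r * (\<mu> r * proj r q))"
    by (simp add: proj_def[of _ q] sum_distrib_left)
  finally show ?thesis unfolding gradmat_def .
qed

text \<open>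
  The part of the trace with both indices in \<open>J\<close> cancels by antisymmetry, which leaves the positive terms
  across the gap.
\<close>

lemma first_variation: "(\<Sum>a\<in>K. \<Sum>j\<in>J. grad a j * y a j) = coupling"
proof -
  have "(\<Sum>a\<in>K. \<Sum>j\<in>J. grad a j * y a j) = (\<Sum>j\<in>J. gradmat j j)"
    by (subst sum.swap) (simp add: gradmat_eq)
  also have "\<dots> = (\<Sum>j\<in>J. \<Sum>r\<in>J \<union> Q. (\<mu> j - \<mu> r) * (proj r j)\<^sup>2)"
  proof (intro sum.cong refl)
    fix j
    have "proj j r * (\<mu> r * proj r j) = \<mu> r * (proj r j)\<^sup>2" "(proj j r)\<^sup>2 = (proj r j)\<^sup>2" for r
      using proj_sym[of j r] by (simp_all add: power2_eq_square)
    then have "(\<Sum>r\<in>J \<union> Q. proj j r * (\<mu> r * proj r j)) = (\<Sum>r\<in>J \<union> Q. \<mu> r * (proj r j)\<^sup>2)"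
        "(\<Sum>r\<in>J \<union> Q. (proj j r)\<^sup>2) = (\<Sum>r\<in>J \<union> Q. (proj r j)\<^sup>2)"
      by (simp_all only:)
    then have "gradmat j j = \<mu> j * (\<Sum>r\<in>J \<union> Q. (proj r j)\<^sup>2) - (\<Sum>r\<in>J \<union> Q. \<mu> r * (proj r j)\<^sup>2)"
      using proj_row_norm[of j] unfolding gradmat_def by simp
    then show "gradmat j j = (\<Sum>r\<in>J \<union> Q. (\<mu> j - \<mu> r) * (proj r j)\<^sup>2)"
      by (simp only: sum_distrib_left sum_subtractf left_diff_distrib)
  qed
  also have "\<dots> = (\<Sum>j\<in>J. \<Sum>r\<in>J. (\<mu> j - \<mu> r) * (proj r j)\<^sup>2) + coupling"
    unfolding coupling_def by (simp add: sum_J_Q sum.distrib sum.swap[of _ Q])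
  also have "(\<Sum>j\<in>J. \<Sum>r\<in>J. (\<mu> j - \<mu> r) * (proj r j)\<^sup>2) = 0"
  proof -
    have "(\<Sum>j\<in>J. \<Sum>r\<in>J. (\<mu> j - \<mu> r) * (proj r j)\<^sup>2) = (\<Sum>j\<in>J. \<Sum>r\<in>J. (\<mu> r - \<mu> j) * (proj j r)\<^sup>2)"
      by (rule sum.swap)
    also have "\<dots> = (\<Sum>j\<in>J. \<Sum>r\<in>J. - ((\<mu> j - \<mu> r) * (proj r j)\<^sup>2))"
    proof (intro sum.cong refl)
      fix j r
      show "(\<mu> r - \<mu> j) * (proj j r)\<^sup>2 = - ((\<mu> j - \<mu> r) * (proj r j)\<^sup>2)"
        using proj_sym[of j r] by (simp add: algebra_simps)
    qed
    finally show ?thesis by (simp add: sum_negf)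
  qed
  finally show ?thesis by simp
qed

lemma grad_orthogonal:
  assumes "b \<in> K"
  shows "(\<Sum>q\<in>J \<union> Q. y b q * grad a q) = 0"
  unfolding grad_def right_diff_distrib sum_subtractf proj_apply inner_basis_combination[OF assms]
  by simp

text \<open>
  The left-hand side is the second-order change of the defect along the geodesic: mass that enters \<open>Q\<close> through
  \<open>G\<close> minus mass that leaves it because \<open>y\<close> is rotated away. Written with matrices it is
  \<open>\<parallel>P\<^sub>Q G Y\<^sup>T P\<^sub>J\<parallel>\<^sup>2 - \<parallel>P\<^sub>J G Y\<^sup>T P\<^sub>Q\<parallel>\<^sup>2\<close>, because the columns of \<open>G\<close> are orthogonal with norms \<open>s a\<close>.
\<close>

lemma second_variation:
  assumes orth: "\<And>a b. a \<in> K \<Longrightarrow> b \<in> K \<Longrightarrow>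
      (\<Sum>q\<in>J \<union> Q. G a q * G b q) = (if a = b then (s a)\<^sup>2 else 0)"
  shows "(\<Sum>a\<in>K. (\<Sum>p\<in>Q. (G a p)\<^sup>2) - (s a)\<^sup>2 * (\<Sum>p\<in>Q. (y a p)\<^sup>2))
      \<le> (\<Sum>p\<in>Q. \<Sum>j\<in>J. (\<Sum>a\<in>K. G a p * y a j)\<^sup>2)"
proof -
  have expand: "(\<Sum>p\<in>S. \<Sum>j\<in>S'. (\<Sum>a\<in>K. G a p * y a j)\<^sup>2)
      = (\<Sum>a\<in>K. \<Sum>b\<in>K. (\<Sum>p\<in>S. G a p * G b p) * (\<Sum>j\<in>S'. y a j * y b j))" for S S'
  proof -
    have "(\<Sum>p\<in>S. \<Sum>j\<in>S'. (\<Sum>a\<in>K. G a p * y a j)\<^sup>2)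
        = (\<Sum>p\<in>S. \<Sum>j\<in>S'. \<Sum>a\<in>K. \<Sum>b\<in>K. G a p * G b p * (y a j * y b j))"
      by (simp add: power2_eq_square sum_product mult_ac)
    also have "\<dots> = (\<Sum>p\<in>S. \<Sum>a\<in>K. \<Sum>b\<in>K. \<Sum>j\<in>S'. G a p * G b p * (y a j * y b j))"
      by (simp add: sum.swap[of _ _ S'])
    also have "\<dots> = (\<Sum>a\<in>K. \<Sum>b\<in>K. \<Sum>p\<in>S. \<Sum>j\<in>S'. G a p * G b p * (y a j * y b j))"
      by (simp add: sum.swap[of _ _ S])
    also have "\<dots> = (\<Sum>a\<in>K. \<Sum>b\<in>K. (\<Sum>p\<in>S. G a p * G b p) * (\<Sum>j\<in>S'. y a j * y b j))"
      by (simp only: sum_product)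
    finally show ?thesis .
  qed
  have entry: "(\<Sum>p\<in>Q. G a p * G b p) * (\<Sum>j\<in>J. y a j * y b j)
      = (if a = b then (\<Sum>p\<in>Q. (G a p)\<^sup>2) - (s a)\<^sup>2 * (\<Sum>p\<in>Q. (y a p)\<^sup>2) else 0)
        + (\<Sum>p\<in>J. G a p * G b p) * (\<Sum>j\<in>Q. y a j * y b j)" if "a \<in> K" "b \<in> K" for a b
  proof -
    have G: "(\<Sum>p\<in>J. G a p * G b p) = (if a = b then (s a)\<^sup>2 else 0) - (\<Sum>p\<in>Q. G a p * G b p)"
      using orth[OF that] unfolding sum_J_Q by linarith
    have y: "(\<Sum>j\<in>J. y a j * y b j) = (if a = b then 1 else 0) - (\<Sum>j\<in>Q. y a j * y b j)"
      using orthonormal[OF that] unfolding sum_J_Q by linarith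
    show ?thesis unfolding G y by (auto simp: algebra_simps power2_eq_square)
  qed
  have "(\<Sum>p\<in>Q. \<Sum>j\<in>J. (\<Sum>a\<in>K. G a p * y a j)\<^sup>2)
      = (\<Sum>a\<in>K. (\<Sum>p\<in>Q. (G a p)\<^sup>2) - (s a)\<^sup>2 * (\<Sum>p\<in>Q. (y a p)\<^sup>2))
        + (\<Sum>p\<in>J. \<Sum>j\<in>Q. (\<Sum>a\<in>K. G a p * y a j)\<^sup>2)"
    unfolding expand using finite_K by (simp add: entry sum.distrib)
  moreover have "0 \<le> (\<Sum>p\<in>J. \<Sum>j\<in>Q. (\<Sum>a\<in>K. G a p * y a j)\<^sup>2)"
    by (intro sum_nonneg) auto
  ultimately show ?thesis by linarith
qed

text \<open>
  The contraction of the defect: the two variations and the error of linearising the sines, put together. The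
  gradient determines \<open>u a\<close>, and makes it orthogonal to the family \<open>y\<close>, only where \<open>s a\<close> is nonzero; this is
  why the case \<open>s a = 0\<close> is treated apart.
\<close>

lemma geodesic_step:
  assumes u_orthonormal: "\<And>a b. a \<in> K \<Longrightarrow> b \<in> K \<Longrightarrow>
      (\<Sum>q\<in>J \<union> Q. u a q * u b q) = (if a = b then 1 else 0)"
    and s_nonneg: "\<And>a. a \<in> K \<Longrightarrow> 0 \<le> s a"
    and tangent: "\<And>a q. a \<in> K \<Longrightarrow> q \<in> J \<union> Q \<Longrightarrow> (l1 + l2) * (s a * u a q) = grad a q"
    and L: "0 < l1 + l2" and small: "defect \<le> 5 / 8"
  shows "(\<Sum>a\<in>K. \<Sum>p\<in>Q. (cos (s a) * y a p + sin (s a) * u a p)\<^sup>2)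
      \<le> (1 - 3 * \<delta> / (1600 * (l1 + l2))) * defect"
proof -
  define L where "L = l1 + l2"
  define e where "e a = (\<Sum>j\<in>J. y a j * u a j)" for a
  define Y where "Y a = (\<Sum>p\<in>Q. (y a p)\<^sup>2)" for a
  define U where "U a = (\<Sum>p\<in>Q. (u a p)\<^sup>2)" for a
  have L_pos: "0 < L" using L by (simp add: L_def)
  have y_unit: "(\<Sum>q\<in>J \<union> Q. (y a q)\<^sup>2) = 1" if "a \<in> K" for a
    using orthonormal[OF that that] by (simp add: power2_eq_square)
  have u_unit: "(\<Sum>q\<in>J \<union> Q. (u a q)\<^sup>2) = 1" if "a \<in> K" for a
    using u_orthonormal[OF that that] by (simp add: power2_eq_square)
  have grad_eq: "grad a q = L * (s a * u a q)" if "a \<in> K" "q \<in> J \<union> Q" for a q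
    using tangent[OF that] by (simp add: L_def)
  have half: "\<bar>y a q * u a q\<bar> \<le> ((y a q)\<^sup>2 + (u a q)\<^sup>2) / 2" for a q
  proof -
    have "0 \<le> (\<bar>y a q\<bar> - \<bar>u a q\<bar>)\<^sup>2" by simp
    then show ?thesis by (simp add: power2_diff abs_mult)
  qed
  have abs_inner: "(\<Sum>q\<in>J \<union> Q. \<bar>y a q * u a q\<bar>) \<le> 1" if "a \<in> K" for a
  proof -
    have "(\<Sum>q\<in>J \<union> Q. \<bar>y a q * u a q\<bar>) \<le> (\<Sum>q\<in>J \<union> Q. ((y a q)\<^sup>2 + (u a q)\<^sup>2) / 2)"
      by (intro sum_mono half)
    also have "\<dots> = 1"
      using y_unit[OF that] u_unit[OF that]
      by (simp add: add_divide_distrib sum.distrib flip: sum_divide_distrib)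
    finally show ?thesis .
  qed
  have y_u: "(\<Sum>q\<in>J \<union> Q. y b q * u a q) = 0" if "a \<in> K" "b \<in> K" "s a \<noteq> 0" for a b
  proof -
    have "L * s a * (\<Sum>q\<in>J \<union> Q. y b q * u a q) = (\<Sum>q\<in>J \<union> Q. y b q * grad a q)"
      unfolding sum_distrib_left by (intro sum.cong refl) (use grad_eq that in \<open>simp add: mult_ac\<close>)
    then show ?thesis using grad_orthogonal[OF that(2)] that(3) L_pos by simp
  qed
  have s_le: "s a \<le> 1 / 2" if a: "a \<in> K" for a
  proof (cases "s a = 0")
    case False
    \<comment> \<open>Shifted by the midpoint of the spectrum, the operator has norm L / 2; hence the bound 1/2.\<close>
    define c where "c = (l1 - l2) / 2"
    have mid: "\<bar>\<mu> q - c\<bar> \<le> L / 2" if "q \<in> J \<union> Q" for q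
    proof -
      have "- l2 \<le> \<mu> q \<and> \<mu> q \<le> l1"
        using that upper[of q] lower[of q] bounds_nonneg by force
      then show ?thesis unfolding c_def L_def abs_le_iff by argo
    qed
    have "L * s a = L * s a * (\<Sum>q\<in>J \<union> Q. (u a q)\<^sup>2)" using u_unit[OF a] by simp
    also have "\<dots> = (\<Sum>q\<in>J \<union> Q. u a q * grad a q)"
      unfolding sum_distrib_left
      by (intro sum.cong refl) (use grad_eq a in \<open>simp add: mult_ac power2_eq_square\<close>)
    also have "\<dots> = (\<Sum>q\<in>J \<union> Q. u a q * (\<mu> q * y a q))
        - (\<Sum>q\<in>J \<union> Q. (\<Sum>b\<in>K. (\<Sum>r\<in>J \<union> Q. y b r * (\<mu> r * y a r)) * y b q) * u a q)"
      unfolding grad_def right_diff_distrib sum_subtractf proj_apply by (simp add: mult_ac)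
    also have "(\<Sum>q\<in>J \<union> Q. (\<Sum>b\<in>K. (\<Sum>r\<in>J \<union> Q. y b r * (\<mu> r * y a r)) * y b q) * u a q) = 0"
      unfolding inner_combination by (simp add: y_u a False)
    also have "(\<Sum>q\<in>J \<union> Q. u a q * (\<mu> q * y a q)) - 0 = (\<Sum>q\<in>J \<union> Q. (\<mu> q - c) * (y a q * u a q))"
    proof -
      have "(\<Sum>q\<in>J \<union> Q. (\<mu> q - c) * (y a q * u a q))
          = (\<Sum>q\<in>J \<union> Q. u a q * (\<mu> q * y a q)) - c * (\<Sum>q\<in>J \<union> Q. y a q * u a q)"
        unfolding sum_distrib_left left_diff_distrib sum_subtractf by (simp add: mult_ac)
      then show ?thesis using y_u[OF a a False] by simp
    qed
    also have "\<dots> \<le> (\<Sum>q\<in>J \<union> Q. L / 2 * \<bar>y a q * u a q\<bar>)"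
    proof (rule sum_mono)
      fix q assume "q \<in> J \<union> Q"
      have "(\<mu> q - c) * (y a q * u a q) \<le> \<bar>\<mu> q - c\<bar> * \<bar>y a q * u a q\<bar>"
        unfolding abs_mult[symmetric] by simp
      also have "\<dots> \<le> L / 2 * \<bar>y a q * u a q\<bar>"
        using mid[OF \<open>q \<in> J \<union> Q\<close>] by (intro mult_right_mono) auto
      finally show "(\<mu> q - c) * (y a q * u a q) \<le> L / 2 * \<bar>y a q * u a q\<bar>" .
    qed
    also have "\<dots> \<le> L / 2 * 1"
      unfolding sum_distrib_left[symmetric] using abs_inner[OF a] L_pos by (intro mult_left_mono) auto
    finally have "L * s a \<le> L * (1 / 2)" by simp
    then show ?thesis using L_pos by (simp only: mult_le_cancel_left_pos)
  qed simp
  have Y_bounds: "0 \<le> Y a" "Y a \<le> defect" if "a \<in> K" for a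
    unfolding defect_eq Y_def using that finite_K
    by (auto intro!: sum_nonneg member_le_sum[of a K "\<lambda>a. \<Sum>p\<in>Q. (y a p)\<^sup>2"])
  have U_nonneg: "0 \<le> U a" for a unfolding U_def by (intro sum_nonneg) auto
  have angle_step: "(\<Sum>p\<in>Q. (cos (s a) * y a p + sin (s a) * u a p)\<^sup>2)
      \<le> Y a + ((s a)\<^sup>2 * U a - (s a)\<^sup>2 * Y a) - 2 * (s a * e a) + (32 / 100 + defect / 12) * (s a)\<^sup>2"
    if a: "a \<in> K" for a
  proof (cases "s a = 0")
    case True
    then show ?thesis by (simp add: Y_def)
  next
    case False
    define x where "x = s a"
    have x: "0 \<le> x" "x \<le> 1 / 2" using s_nonneg[OF a] s_le[OF a] by (simp_all add: x_def)
    have "e a + (\<Sum>p\<in>Q. y a p * u a p) = 0"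
      using y_u[OF a a False] unfolding e_def sum_J_Q .
    then have eQ: "(\<Sum>p\<in>Q. y a p * u a p) = - e a" by linarith
    have "\<bar>e a\<bar> + \<bar>\<Sum>p\<in>Q. y a p * u a p\<bar> \<le> 1"
      using abs_inner[OF a] sum_abs[of "\<lambda>q. y a q * u a q" J] sum_abs[of "\<lambda>q. y a q * u a q" Q]
      unfolding e_def sum_J_Q by linarith
    then have e_le: "\<bar>e a\<bar> \<le> 1 / 2" unfolding eQ by simp
    have "(\<Sum>p\<in>Q. (cos x * y a p + sin x * u a p)\<^sup>2)
        = (\<Sum>p\<in>Q. (cos x)\<^sup>2 * (y a p)\<^sup>2 + (sin x)\<^sup>2 * (u a p)\<^sup>2 + 2 * sin x * cos x * (y a p * u a p))"
      by (simp add: power2_sum power_mult_distrib mult_ac)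
    also have "\<dots> = (cos x)\<^sup>2 * Y a + (sin x)\<^sup>2 * U a - sin (2 * x) * e a"
      by (simp add: sum.distrib Y_def U_def sin_double eQ flip: sum_distrib_left)
    also have "\<dots> = Y a + (x\<^sup>2 * U a - x\<^sup>2 * Y a) - 2 * (x * e a)
        + ((x\<^sup>2 - (sin x)\<^sup>2) * Y a - (x\<^sup>2 - (sin x)\<^sup>2) * U a + (2 * x - sin (2 * x)) * e a)"
      unfolding cos_squared_eq by (simp add: algebra_simps)
    finally have expansion: "(\<Sum>p\<in>Q. (cos x * y a p + sin x * u a p)\<^sup>2)
        = Y a + (x\<^sup>2 * U a - x\<^sup>2 * Y a) - 2 * (x * e a)
          + ((x\<^sup>2 - (sin x)\<^sup>2) * Y a - (x\<^sup>2 - (sin x)\<^sup>2) * U a + (2 * x - sin (2 * x)) * e a)" .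
    have Y_error: "(x\<^sup>2 - (sin x)\<^sup>2) * Y a \<le> x\<^sup>2 / 12 * defect"
      using sin_squared_ge[OF x] Y_bounds[OF a] by (intro mult_mono) auto
    have U_error: "0 \<le> (x\<^sup>2 - (sin x)\<^sup>2) * U a"
    proof (intro mult_nonneg_nonneg U_nonneg)
      have "\<bar>sin x\<bar> \<le> \<bar>x\<bar>" by (rule abs_sin_x_le_abs_x)
      then show "0 \<le> x\<^sup>2 - (sin x)\<^sup>2" by (simp add: abs_le_square_iff)
    qed
    have e_error: "(2 * x - sin (2 * x)) * e a \<le> (16 / 100 * (2 * x)\<^sup>2) * (1 / 2)"
    proof -
      have "(2 * x - sin (2 * x)) * e a \<le> (2 * x - sin (2 * x)) * \<bar>e a\<bar>"
        using sin_x_le_x[of "2 * x"] x by (intro mult_left_mono) auto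
      also have "\<dots> \<le> (16 / 100 * (2 * x)\<^sup>2) * (1 / 2)"
        using sin_ge_quadratic[of "2 * x"] x e_le by (intro mult_mono) auto
      finally show ?thesis .
    qed
    have "x\<^sup>2 / 12 * defect + (16 / 100 * (2 * x)\<^sup>2) * (1 / 2) = (32 / 100 + defect / 12) * x\<^sup>2"
      by (simp add: algebra_simps power2_eq_square)
    with expansion Y_error U_error e_error show ?thesis
      unfolding x_def[symmetric] by linarith
  qed
  have first: "(\<Sum>a\<in>K. s a * e a) = coupling / L"
  proof -
    have "L * (\<Sum>a\<in>K. s a * e a) = (\<Sum>a\<in>K. \<Sum>j\<in>J. grad a j * y a j)"
      unfolding e_def sum_distrib_left by (intro sum.cong refl) (simp add: grad_eq mult_ac)
    then show ?thesis unfolding first_variation using L_pos by (simp add: field_simps)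
  qed
  have second: "(\<Sum>a\<in>K. (s a)\<^sup>2 * U a - (s a)\<^sup>2 * Y a) \<le> coupling / L"
  proof -
    have "(\<Sum>a\<in>K. (\<Sum>p\<in>Q. (s a * u a p)\<^sup>2) - (s a)\<^sup>2 * (\<Sum>p\<in>Q. (y a p)\<^sup>2))
        \<le> (\<Sum>p\<in>Q. \<Sum>j\<in>J. (\<Sum>a\<in>K. s a * u a p * y a j)\<^sup>2)"
    proof (rule second_variation)
      fix a b assume ab: "a \<in> K" "b \<in> K"
      have "(\<Sum>q\<in>J \<union> Q. s a * u a q * (s b * u b q)) = s a * s b * (\<Sum>q\<in>J \<union> Q. u a q * u b q)"
        unfolding sum_distrib_left by (intro sum.cong refl) (simp add: mult_ac)
      then show "(\<Sum>q\<in>J \<union> Q. s a * u a q * (s b * u b q)) = (if a = b then (s a)\<^sup>2 else 0)"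
        using u_orthonormal[OF ab] by (simp add: power2_eq_square)
    qed
    also have "\<dots> = (\<Sum>p\<in>Q. \<Sum>j\<in>J. (gradmat p j)\<^sup>2) / L\<^sup>2"
    proof -
      have "(\<Sum>a\<in>K. s a * u a p * y a j) = gradmat p j / L" if "p \<in> Q" for p j
      proof -
        have "L * (\<Sum>a\<in>K. s a * u a p * y a j) = gradmat p j"
          unfolding gradmat_eq[symmetric] sum_distrib_left
          by (intro sum.cong refl) (simp add: grad_eq that mult_ac)
        then show ?thesis using L_pos by (simp add: field_simps)
      qed
      then show ?thesis by (simp add: power_divide sum_divide_distrib)
    qed
    also have "\<dots> \<le> L * coupling / L\<^sup>2"
      using grad_block_norm unfolding L_def by (intro divide_right_mono) auto
    also have "\<dots> = coupling / L" using L_pos by (simp add: power2_eq_square)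
    finally show ?thesis by (simp add: U_def Y_def power_mult_distrib sum_distrib_left)
  qed
  have norm: "(1 - defect) * (\<Sum>a\<in>K. (s a)\<^sup>2) \<le> coupling / L"
  proof -
    have "(\<Sum>q\<in>J \<union> Q. (grad a q)\<^sup>2) = L\<^sup>2 * (s a)\<^sup>2" if "a \<in> K" for a
    proof -
      have "(\<Sum>q\<in>J \<union> Q. (grad a q)\<^sup>2) = (L * s a)\<^sup>2 * (\<Sum>q\<in>J \<union> Q. (u a q)\<^sup>2)"
        unfolding sum_distrib_left
        by (intro sum.cong refl) (simp add: grad_eq that power_mult_distrib mult_ac)
      then show ?thesis by (simp add: u_unit[OF that] power_mult_distrib)
    qed
    then have "(\<Sum>a\<in>K. \<Sum>q\<in>J \<union> Q. (grad a q)\<^sup>2) = L\<^sup>2 * (\<Sum>a\<in>K. (s a)\<^sup>2)"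
      by (simp add: sum_distrib_left)
    then have "(1 - defect) * (L\<^sup>2 * (\<Sum>a\<in>K. (s a)\<^sup>2)) \<le> L * coupling"
      using grad_norm small by (simp add: L_def)
    then have "L * (L * ((1 - defect) * (\<Sum>a\<in>K. (s a)\<^sup>2))) \<le> L * coupling"
      by (simp only: power2_eq_square mult_ac)
    then have "L * ((1 - defect) * (\<Sum>a\<in>K. (s a)\<^sup>2)) \<le> coupling"
      using L_pos by (simp only: mult_le_cancel_left_pos)
    then show ?thesis using L_pos by (simp only: pos_le_divide_eq mult_ac)
  qed
  define N where "N = (\<Sum>a\<in>K. (s a)\<^sup>2)"
  have N_nonneg: "0 \<le> N" unfolding N_def by (intro sum_nonneg) auto
  have "(\<Sum>a\<in>K. \<Sum>p\<in>Q. (cos (s a) * y a p + sin (s a) * u a p)\<^sup>2)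
      \<le> (\<Sum>a\<in>K. Y a + ((s a)\<^sup>2 * U a - (s a)\<^sup>2 * Y a) - 2 * (s a * e a) + (32 / 100 + defect / 12) * (s a)\<^sup>2)"
    by (intro sum_mono angle_step)
  also have "\<dots> = defect + (\<Sum>a\<in>K. (s a)\<^sup>2 * U a - (s a)\<^sup>2 * Y a) - 2 * (\<Sum>a\<in>K. s a * e a)
      + (32 / 100 + defect / 12) * N"
    unfolding sum.distrib sum_subtractf sum_distrib_left[symmetric] N_def by (simp add: defect_eq Y_def)
  also have "\<dots> \<le> defect - coupling / L + (32 / 100 + defect / 12) * N"
    using first second by simp
  also have "(32 / 100 + defect / 12) * N \<le> 199 / 200 * (coupling / L)"
  proof -
    have "(32 / 100 + defect / 12) * N \<le> (199 / 200 * (1 - defect)) * N"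
      \<comment> \<open>At defect 5/8 the ratio (0.32 + 5/96) / (3/8) is about 0.992, just below 199/200.\<close>
      using small N_nonneg by (intro mult_right_mono) auto
    also have "\<dots> \<le> 199 / 200 * (coupling / L)"
      unfolding N_def mult.assoc by (rule mult_left_mono[OF norm]) simp
    finally show ?thesis .
  qed
  also have "defect - coupling / L + 199 / 200 * (coupling / L) = defect - coupling / L / 200"
    by simp
  also have "\<dots> \<le> defect - 3 / 8 * \<delta> * defect / L / 200"
  proof -
    have "\<delta> * (3 / 8) * defect \<le> \<delta> * (1 - defect) * defect"
      using small bounds_nonneg defect_nonneg by (intro mult_right_mono mult_left_mono) auto
    also have "\<dots> \<le> coupling" using coupling_ge small by simp
    finally have "3 / 8 * \<delta> * defect / L / 200 \<le> coupling / L / 200"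
      using L_pos by (intro divide_right_mono) (auto simp: mult_ac)
    then show ?thesis by linarith
  qed
  also have "\<dots> = (1 - 3 * \<delta> / (1600 * L)) * defect"
    by (simp add: algebra_simps)
  finally show ?thesis by (simp add: L_def)
qed

end

section \<open>Existence of the singular value decomposition\<close>

lemma scalar_prod_self_nonneg: "0 \<le> x \<bullet> (x :: real vec)"
  unfolding scalar_prod_def by (intro sum_nonneg) auto

lemma scalar_prod_self_eq_0:
  assumes "x \<in> carrier_vec n" "x \<bullet> (x :: real vec) = 0"
  shows "x = 0\<^sub>v n"
proof (rule eq_vecI)
  fix i assume "i < dim_vec (0\<^sub>v n :: real vec)"
  moreover have "\<forall>i\<in>{0..<dim_vec x}. x $ i * x $ i = 0"
    using assms(2) unfolding scalar_prod_def by (subst (asm) sum_nonneg_eq_0_iff) auto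
  ultimately show "x $ i = 0\<^sub>v n $ i" using assms(1) by auto
qed (use assms in auto)

text \<open>
  The square matrix whose rows are the given vectors, padded by zero rows, is singular.
\<close>

lemma unit_vector_orthogonal_exists:
  fixes w :: "nat \<Rightarrow> real vec"
  assumes "m < n" and w: "\<And>i. i < m \<Longrightarrow> w i \<in> carrier_vec n"
  shows "\<exists>x\<in>carrier_vec n. x \<bullet> x = 1 \<and> (\<forall>i<m. w i \<bullet> x = 0)"
proof -
  define c where "c i = (if i < m then w i else 0\<^sub>v n)" for i
  define M where "M = mat\<^sub>r n n (\<lambda>i. if i = m then 0\<^sub>v n else c i)"
  have M: "M \<in> carrier_mat n n" unfolding M_def by simp
  have "det M = 0" unfolding M_def
    by (rule det_row_0) (use assms in \<open>auto simp: c_def\<close>)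
  then obtain z where z: "z \<in> carrier_vec n" "z \<noteq> 0\<^sub>v n" "M *\<^sub>v z = 0\<^sub>v n"
    using det_0_iff_vec_prod_zero_field[OF M] by auto
  have orth: "w i \<bullet> z = 0" if "i < m" for i
  proof -
    have "(M *\<^sub>v z) $ i = row M i \<bullet> z" using that assms(1) M by simp
    moreover have "row M i = w i"
      using that assms(1) w[OF that] unfolding M_def c_def by (subst row_mat_of_row_fun) auto
    ultimately show ?thesis using z(3) that assms(1) by simp
  qed
  have pos: "0 < z \<bullet> z"
    using scalar_prod_self_nonneg[of z] scalar_prod_self_eq_0[OF z(1)] z(2) by linarith
  define x where "x = (1 / sqrt (z \<bullet> z)) \<cdot>\<^sub>v z"
  have "x \<bullet> x = 1 / sqrt (z \<bullet> z) * (1 / sqrt (z \<bullet> z)) * (z \<bullet> z)"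
    unfolding x_def by simp
  also have "\<dots> = 1" using pos by (simp add: field_simps)
  finally have "x \<bullet> x = 1" .
  moreover have "w i \<bullet> x = 0" if "i < m" for i
    using orth[OF that] w[OF that] z(1) unfolding x_def by simp
  ultimately show ?thesis using z(1) unfolding x_def by (intro bexI[of _ x]) (auto simp: x_def)
qed

text \<open>
  The maximum exists because the constraint set, viewed as a set of sequences supported on the first \<open>k\<close>
  indices, is closed in a product of compact intervals.
\<close>

lemma singular_vector_exists:
  fixes G :: "real mat" and v :: "nat \<Rightarrow> real vec"
  assumes G: "G \<in> carrier_mat n k" and "m < k" and v: "\<And>i. i < m \<Longrightarrow> v i \<in> carrier_vec k"
  shows "\<exists>x\<in>carrier_vec k. x \<bullet> x = 1 \<and> (\<forall>i<m. v i \<bullet> x = 0) \<and>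
    (\<forall>z\<in>carrier_vec k. (\<forall>i<m. v i \<bullet> z = 0) \<longrightarrow> (G *\<^sub>v z) \<bullet> (G *\<^sub>v z) \<le> (G *\<^sub>v x) \<bullet> (G *\<^sub>v x) * (z \<bullet> z))"
proof -
  \<comment> \<open>The form and the constraints as functions of a sequence, on which the product topology lives.\<close>
  define q where "q f = (\<Sum>a<n. (\<Sum>i<k. G $$ (a, i) * f i)\<^sup>2)" for f :: "nat \<Rightarrow> real"
  define S where "S = {f :: nat \<Rightarrow> real. (\<forall>i. f i \<in> {-1..1}) \<and> (\<forall>i\<ge>k. f i = 0)
      \<and> (\<Sum>i<k. (f i)\<^sup>2) = 1 \<and> (\<forall>j<m. (\<Sum>i<k. v j $ i * f i) = 0)}"
  have q_eq: "(G *\<^sub>v z) \<bullet> (G *\<^sub>v z) = q (\<lambda>i. z $ i)" if "z \<in> carrier_vec k" for z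
    using G that unfolding q_def scalar_prod_def
    by (intro sum.cong) (auto simp: scalar_prod_def power2_eq_square lessThan_atLeast0)
  have norm_eq: "z \<bullet> z = (\<Sum>i<k. (z $ i)\<^sup>2)" if "z \<in> carrier_vec k" for z :: "real vec"
    using that unfolding scalar_prod_def by (simp add: power2_eq_square lessThan_atLeast0)
  have orth_eq: "v j \<bullet> z = (\<Sum>i<k. v j $ i * z $ i)" if "z \<in> carrier_vec k" for z j
    using that unfolding scalar_prod_def by (simp add: lessThan_atLeast0)
  have in_S: "(\<lambda>i. if i < k then z $ i else 0) \<in> S"
    if z: "z \<in> carrier_vec k" "z \<bullet> z = 1" "\<forall>i<m. v i \<bullet> z = 0" for z
  proof -
    have "\<bar>z $ i\<bar> \<le> 1" if "i < k" for i
    proof -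
      have "(z $ i)\<^sup>2 \<le> (\<Sum>i<k. (z $ i)\<^sup>2)"
        using that by (intro member_le_sum) auto
      then show ?thesis using z norm_eq[OF z(1)] by (simp add: abs_square_le_1)
    qed
    then show ?thesis
      using z norm_eq[OF z(1)] orth_eq[OF z(1)] unfolding S_def by (auto simp: abs_le_iff minus_le_iff)
  qed
  have "compact (PiE UNIV (\<lambda>_. {-1..1::real}) :: (nat \<Rightarrow> real) set)"
    using compactin_PiE[of "\<lambda>_. euclidean" UNIV "\<lambda>_. {-1..1::real}"]
    by (simp add: euclidean_product_topology)
  moreover have "closed S"
  proof -
    have "closed {f :: nat \<Rightarrow> real. f i \<in> {-1..1}}" for i
      unfolding atLeastAtMost_iff Collect_conj_eq
      by (intro closed_Int closed_Collect_le continuous_intros) auto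
    moreover have "closed {f :: nat \<Rightarrow> real. i \<ge> k \<longrightarrow> f i = 0}" for i
      by (intro closed_Collect_imp closed_Collect_eq continuous_intros) auto
    moreover have "closed {f :: nat \<Rightarrow> real. (\<Sum>i<k. (f i)\<^sup>2) = 1}"
      by (intro closed_Collect_eq continuous_intros) auto
    moreover have "closed {f :: nat \<Rightarrow> real. j < m \<longrightarrow> (\<Sum>i<k. v j $ i * f i) = 0}" for j
      by (intro closed_Collect_imp closed_Collect_eq continuous_intros) auto
    ultimately show ?thesis
      unfolding S_def by (intro closed_Collect_conj closed_Collect_all) auto
  qed
  moreover have "S \<subseteq> PiE UNIV (\<lambda>_. {-1..1})" unfolding S_def by auto
  ultimately have "compact S" using compact_Int_closed by (metis inf.absorb2)
  moreover have "S \<noteq> {}"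
    using unit_vector_orthogonal_exists[of m k v] assms in_S by blast
  moreover have "continuous_on S q" unfolding q_def
    by (intro continuous_intros continuous_on_subset[OF continuous_on_product_coordinates]) auto
  ultimately obtain f where f: "f \<in> S" "\<And>g. g \<in> S \<Longrightarrow> q g \<le> q f"
    using continuous_attains_sup by metis
  define x where "x = vec k f"
  have x: "x \<in> carrier_vec k" unfolding x_def by simp
  have qx: "(G *\<^sub>v x) \<bullet> (G *\<^sub>v x) = q f"
    unfolding q_eq[OF x] by (simp add: q_def x_def)
  have "x \<bullet> x = 1" "\<forall>i<m. v i \<bullet> x = 0"
    unfolding norm_eq[OF x] orth_eq[OF x] using f(1) by (simp_all add: S_def x_def)
  moreover have "(G *\<^sub>v z) \<bullet> (G *\<^sub>v z) \<le> (G *\<^sub>v x) \<bullet> (G *\<^sub>v x) * (z \<bullet> z)"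
    if z: "z \<in> carrier_vec k" "\<forall>i<m. v i \<bullet> z = 0" for z
  proof (cases "z \<bullet> z = 0")
    case True
    then have "z = 0\<^sub>v k" using scalar_prod_self_eq_0[OF z(1)] by simp
    then have "G *\<^sub>v z = 0\<^sub>v n" using G by auto
    then show ?thesis using True by simp
  next
    case False
    then have pos: "0 < z \<bullet> z" using scalar_prod_self_nonneg[of z] by linarith
    define r where "r = sqrt (z \<bullet> z)"
    have r: "r > 0" "r * r = z \<bullet> z" using pos by (simp_all add: r_def)
    define w where "w = (1 / r) \<cdot>\<^sub>v z"
    have w: "w \<in> carrier_vec k" using z by (simp add: w_def)
    have "w \<bullet> w = 1" unfolding w_def using r by (simp flip: r(2))
    moreover have "\<forall>i<m. v i \<bullet> w = 0"
      using z v unfolding w_def by simp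
    ultimately have "q (\<lambda>i. if i < k then w $ i else 0) \<le> q f"
      using f(2) in_S[OF w] by blast
    then have "(G *\<^sub>v w) \<bullet> (G *\<^sub>v w) \<le> q f"
      unfolding q_eq[OF w] by (simp add: q_def)
    moreover have "(G *\<^sub>v w) \<bullet> (G *\<^sub>v w) = (G *\<^sub>v z) \<bullet> (G *\<^sub>v z) / (r * r)"
      unfolding w_def mult_mat_vec[OF G z(1)] by simp
    ultimately show ?thesis unfolding qx r(2) using pos by (simp add: pos_divide_le_eq)
  qed
  ultimately show ?thesis using x by blast
qed

text \<open>
  Right singular vectors chosen greedily: \<open>v i\<close> maximises \<open>\<parallel>G z\<parallel>\<close> among unit vectors orthogonal to its
  predecessors. The maximality is stated in its homogeneous form.
\<close>

definition singular_basis :: "real mat \<Rightarrow> nat \<Rightarrow> nat \<Rightarrow> (nat \<Rightarrow> real vec) \<Rightarrow> bool" where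
  "singular_basis G k m v \<longleftrightarrow>
     (\<forall>i<m. v i \<in> carrier_vec k) \<and> (\<forall>i<m. \<forall>j<m. v i \<bullet> v j = (if i = j then 1 else 0)) \<and>
     (\<forall>i<m. \<forall>z\<in>carrier_vec k. (\<forall>j<i. v j \<bullet> z = 0) \<longrightarrow>
        (G *\<^sub>v z) \<bullet> (G *\<^sub>v z) \<le> (G *\<^sub>v v i) \<bullet> (G *\<^sub>v v i) * (z \<bullet> z))"

lemma singular_basis_exists:
  assumes G: "G \<in> carrier_mat n k"
  shows "m \<le> k \<Longrightarrow> \<exists>v. singular_basis G k m v"
proof (induction m)
  case 0
  then show ?case by (simp add: singular_basis_def)
next
  case (Suc m)
  then obtain v where v: "singular_basis G k m v" by auto
  then have vc: "\<And>i. i < m \<Longrightarrow> v i \<in> carrier_vec k" by (simp add: singular_basis_def)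
  obtain x where x: "x \<in> carrier_vec k" "x \<bullet> x = 1" "\<forall>i<m. v i \<bullet> x = 0"
      "\<forall>z\<in>carrier_vec k. (\<forall>i<m. v i \<bullet> z = 0) \<longrightarrow> (G *\<^sub>v z) \<bullet> (G *\<^sub>v z) \<le> (G *\<^sub>v x) \<bullet> (G *\<^sub>v x) * (z \<bullet> z)"
    using singular_vector_exists[OF G, of m v] vc Suc.prems by auto
  have xv: "x \<bullet> v i = 0" if "i < m" for i
    using x(1,3) vc[OF that] that by (simp add: comm_scalar_prod[of x k])
  have "singular_basis G k (Suc m) (v(m := x))"
    using v x xv unfolding singular_basis_def by (auto simp: less_Suc_eq)
  then show ?case by blast
qed

text \<open>
  Perturbing the maximiser \<open>v i\<close> in the admissible direction \<open>v j\<close> changes the quotient to first order by the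
  inner product of the images, which therefore vanishes.
\<close>

lemma singular_basis_image_orthogonal:
  assumes G: "G \<in> carrier_mat n k" and v: "singular_basis G k m v" and ij: "i < j" "j < m"
  shows "(G *\<^sub>v v i) \<bullet> (G *\<^sub>v v j) = 0"
proof -
  define a b c where "a = (G *\<^sub>v v i) \<bullet> (G *\<^sub>v v i)" and "b = (G *\<^sub>v v i) \<bullet> (G *\<^sub>v v j)"
    and "c = (G *\<^sub>v v j) \<bullet> (G *\<^sub>v v j)"
  have vi: "v i \<in> carrier_vec k" and vj: "v j \<in> carrier_vec k"
    using v ij unfolding singular_basis_def by auto
  have inner: "v i \<bullet> v i = 1" "v j \<bullet> v j = 1" "v i \<bullet> v j = 0" "v j \<bullet> v i = 0"
    using v ij unfolding singular_basis_def by auto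
  have Gc: "G *\<^sub>v v i \<in> carrier_vec n" "G *\<^sub>v v j \<in> carrier_vec n" using G vi vj by auto
  have b': "(G *\<^sub>v v j) \<bullet> (G *\<^sub>v v i) = b" unfolding b_def using Gc by (rule comm_scalar_prod[rotated])
  have bound: "a + 2 * t * b + t\<^sup>2 * c \<le> a * (1 + t\<^sup>2)" for t
  proof -
    define z where "z = v i + t \<cdot>\<^sub>v v j"
    have z: "z \<in> carrier_vec k" using vi vj by (simp add: z_def)
    have "v l \<bullet> z = 0" if "l < i" for l
    proof -
      have "v l \<in> carrier_vec k" "v l \<bullet> v i = 0" "v l \<bullet> v j = 0"
        using v ij that unfolding singular_basis_def by auto
      then show ?thesis using vi vj unfolding z_def by (simp add: scalar_prod_add_distrib[of _ k])
    qed
    then have "(G *\<^sub>v z) \<bullet> (G *\<^sub>v z) \<le> a * (z \<bullet> z)"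
      using v z ij unfolding singular_basis_def a_def by auto
    moreover have "z \<bullet> z = 1 + t\<^sup>2"
      using vi vj inner unfolding z_def
      by (simp add: scalar_prod_add_distrib[of _ k] add_scalar_prod_distrib[of _ k] power2_eq_square)
    moreover have "G *\<^sub>v z = G *\<^sub>v v i + t \<cdot>\<^sub>v (G *\<^sub>v v j)"
      unfolding z_def using G vi vj by (simp add: mult_add_distrib_mat_vec[OF G] mult_mat_vec[OF G])
    moreover have "(G *\<^sub>v v i + t \<cdot>\<^sub>v (G *\<^sub>v v j)) \<bullet> (G *\<^sub>v v i + t \<cdot>\<^sub>v (G *\<^sub>v v j)) = a + 2 * t * b + t\<^sup>2 * c"
      using Gc b'
      by (simp add: scalar_prod_add_distrib[of _ n] add_scalar_prod_distrib[of _ n] power2_eq_square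
        a_def b_def c_def algebra_simps)
    ultimately show ?thesis by simp
  qed
  have a: "0 \<le> a" and c: "0 \<le> c" unfolding a_def c_def by (rule scalar_prod_self_nonneg)+
  \<comment> \<open>The expansion 2 t b + t^2 c <= a t^2 at this t forces t = 0; the summand 1 avoids division by zero.\<close>
  define t where "t = b / (a + 1)"
  have tb: "b = t * (a + 1)" using a by (simp add: t_def)
  have "2 * t * b + t\<^sup>2 * c \<le> a * t\<^sup>2" using bound[of t] by (simp add: distrib_left)
  then have "t\<^sup>2 * (a + 2) + t\<^sup>2 * c \<le> 0"
    unfolding tb by (simp add: power2_eq_square algebra_simps)
  moreover have "0 \<le> t\<^sup>2 * c" "0 \<le> t\<^sup>2 * a" using a c by simp_all
  ultimately have "t\<^sup>2 \<le> 0" unfolding distrib_left by linarith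
  then show ?thesis using tb by (simp add: b_def)
qed

text \<open>
  A left singular vector is the normalised image of the right one. Since the singular values
  decrease, the zero ones come last, and there the family is completed by arbitrary orthogonal unit vectors.
\<close>

lemma left_singular_vectors_exist:
  assumes G: "G \<in> carrier_mat n k" and kn: "k \<le> n" and v: "singular_basis G k k v"
  defines "s \<equiv> \<lambda>i. sqrt ((G *\<^sub>v v i) \<bullet> (G *\<^sub>v v i))"
  assumes decreasing: "\<And>i j. i \<le> j \<Longrightarrow> j < k \<Longrightarrow> s j \<le> s i"
  shows "m \<le> k \<Longrightarrow> \<exists>u. (\<forall>i<m. u i \<in> carrier_vec n) \<and>
    (\<forall>i<m. \<forall>j<m. u i \<bullet> u j = (if i = j then 1 else 0)) \<and> (\<forall>i<m. G *\<^sub>v v i = s i \<cdot>\<^sub>v u i)"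
proof (induction m)
  case 0
  then show ?case by simp
next
  case (Suc m)
  then obtain u where u: "\<And>i. i < m \<Longrightarrow> u i \<in> carrier_vec n"
      "\<And>i j. i < m \<Longrightarrow> j < m \<Longrightarrow> u i \<bullet> u j = (if i = j then 1 else 0)"
      "\<And>i. i < m \<Longrightarrow> G *\<^sub>v v i = s i \<cdot>\<^sub>v u i"
    using Suc.IH Suc_leD[OF Suc.prems] by blast
  have Gc: "G *\<^sub>v v i \<in> carrier_vec n" for i using G by (intro carrier_vecI) simp
  have "\<exists>x\<in>carrier_vec n. x \<bullet> x = 1 \<and> (\<forall>i<m. u i \<bullet> x = 0) \<and> G *\<^sub>v v m = s m \<cdot>\<^sub>v x"
  proof (cases "s m = 0")
    case True
    then have "(G *\<^sub>v v m) \<bullet> (G *\<^sub>v v m) = 0" by (simp add: s_def)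
    then have "G *\<^sub>v v m = 0\<^sub>v n" using scalar_prod_self_eq_0 Gc by blast
    moreover obtain x where "x \<in> carrier_vec n" "x \<bullet> x = 1" "\<forall>i<m. u i \<bullet> x = 0"
      using unit_vector_orthogonal_exists[of m n u] u(1) Suc.prems kn by auto
    ultimately show ?thesis using True by (intro bexI[of _ x]) auto
  next
    case False
    have sq: "s i * s i = (G *\<^sub>v v i) \<bullet> (G *\<^sub>v v i)" for i
      unfolding s_def using scalar_prod_self_nonneg by simp
    have "0 \<le> s m" unfolding s_def using scalar_prod_self_nonneg by simp
    with False have pos: "0 < s m" by simp
    define x where "x = (1 / s m) \<cdot>\<^sub>v (G *\<^sub>v v m)"
    have "u i \<bullet> x = 0" if i: "i < m" for i
    proof -
      have "0 < s i" using decreasing[of i m] pos i Suc.prems by simp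
      moreover have "(s i \<cdot>\<^sub>v u i) \<bullet> (G *\<^sub>v v m) = 0"
        using singular_basis_image_orthogonal[OF G v i] Suc.prems u(3)[OF i] by simp
      ultimately show ?thesis using u(1)[OF i] Gc[of m] G unfolding x_def by simp
    qed
    moreover have "x \<bullet> x = 1" unfolding x_def using sq[of m, symmetric] pos by simp
    moreover have "G *\<^sub>v v m = s m \<cdot>\<^sub>v x" unfolding x_def using pos by (simp add: smult_smult_assoc)
    moreover have "x \<in> carrier_vec n" using Gc[of m] unfolding x_def by simp
    ultimately show ?thesis by blast
  qed
  then obtain x where x: "x \<in> carrier_vec n" "x \<bullet> x = 1" "\<forall>i<m. u i \<bullet> x = 0" "G *\<^sub>v v m = s m \<cdot>\<^sub>v x"
    by blast
  have xu: "x \<bullet> u i = 0" if "i < m" for i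
    using x(1,3) u(1)[OF that] that by (simp add: comm_scalar_prod[of x n])
  let ?u = "u(m := x)"
  have "?u i \<in> carrier_vec n" "G *\<^sub>v v i = s i \<cdot>\<^sub>v ?u i" if "i < Suc m" for i
    by (cases "i = m"; use that u(1,3)[of i] x(1,4) in simp)+
  moreover have "?u i \<bullet> ?u j = (if i = j then 1 else 0)" if "i < Suc m" "j < Suc m" for i j
    using that u(2)[of i j] x(2,3) xu by (auto simp: less_Suc_eq)
  ultimately show ?case by blast
qed

lemma stiefel_iff:
  "X \<in> stiefel n k \<longleftrightarrow> X \<in> carrier_mat n k \<and> (\<forall>i<k. \<forall>j<k. col X i \<bullet> col X j = (if i = j then 1 else 0))"
proof -
  have "X\<^sup>T * X = 1\<^sub>m k \<longleftrightarrow> (\<forall>i<k. \<forall>j<k. col X i \<bullet> col X j = (if i = j then 1 else 0))"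
    if X: "X \<in> carrier_mat n k"
  proof
    assume eq: "X\<^sup>T * X = 1\<^sub>m k"
    show "\<forall>i<k. \<forall>j<k. col X i \<bullet> col X j = (if i = j then 1 else 0)"
    proof (intro allI impI)
      fix i j assume ij: "i < k" "j < k"
      then have "(X\<^sup>T * X) $$ (i, j) = col X i \<bullet> col X j" using X by simp
      then show "col X i \<bullet> col X j = (if i = j then 1 else 0)" using eq ij by simp
    qed
  next
    assume "\<forall>i<k. \<forall>j<k. col X i \<bullet> col X j = (if i = j then 1 else 0)"
    then show "X\<^sup>T * X = 1\<^sub>m k" using X by (intro eq_matI) auto
  qed
  then show ?thesis by (auto simp: stiefel_def)
qed

text \<open>
  The ordering of the singular values serves the principal angles, which are increasing.
\<close>

theorem compact_svd_exists:
  assumes G: "G \<in> carrier_mat n k" and kn: "k \<le> n"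
  shows "\<exists>U s V. compact_svd n k G U s V \<and> (\<forall>i j. i \<le> j \<and> j < k \<longrightarrow> s j \<le> s i)"
proof -
  obtain v where v: "singular_basis G k k v" using singular_basis_exists[OF G] by blast
  define s where "s i = sqrt ((G *\<^sub>v v i) \<bullet> (G *\<^sub>v v i))" for i
  have vc: "v i \<in> carrier_vec k" if "i < k" for i using v that by (simp add: singular_basis_def)
  have decreasing: "s j \<le> s i" if ij: "i \<le> j" "j < k" for i j
  proof -
    have orth: "\<forall>l<i. v l \<bullet> v j = 0" and unit: "v j \<bullet> v j = 1"
      using v ij unfolding singular_basis_def by auto
    have "i < k" using ij by simp
    then have "(G *\<^sub>v v j) \<bullet> (G *\<^sub>v v j) \<le> (G *\<^sub>v v i) \<bullet> (G *\<^sub>v v i) * (v j \<bullet> v j)"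
      using v vc[OF ij(2)] orth unfolding singular_basis_def by blast
    with unit
    show ?thesis by (simp add: s_def)
  qed
  obtain u where u: "\<forall>i<k. u i \<in> carrier_vec n"
      "\<forall>i<k. \<forall>j<k. u i \<bullet> u j = (if i = j then 1 else 0)" "\<forall>i<k. G *\<^sub>v v i = s i \<cdot>\<^sub>v u i"
    using left_singular_vectors_exist[OF G kn v, of k] decreasing unfolding s_def by blast
  define U where "U = mat n k (\<lambda>(i, j). u j $ i)"
  define V where "V = mat k k (\<lambda>(i, j). v j $ i)"
  have U: "U \<in> carrier_mat n k" and V: "V \<in> carrier_mat k k" by (simp_all add: U_def V_def)
  have colU: "col U j = u j" if "j < k" for j
    using u(1) that by (intro eq_vecI) (auto simp: U_def)
  have colV: "col V j = v j" if "j < k" for j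
    using vc[OF that] that by (intro eq_vecI) (auto simp: V_def)
  have stU: "U \<in> stiefel n k" unfolding stiefel_iff using U u(2) by (simp add: colU)
  have stV: "V \<in> stiefel k k"
    unfolding stiefel_iff using V v by (simp add: colV singular_basis_def)
  have "G * V = U * mat_diag k s"
  proof (rule eq_matI)
    fix i j assume "i < dim_row (U * mat_diag k s)" "j < dim_col (U * mat_diag k s)"
    then have ij: "i < n" "j < k" using U by (auto simp: mat_diag_def)
    have "(G * V) $$ (i, j) = (G *\<^sub>v col V j) $ i" using ij G V by simp
    also have "\<dots> = s j * u j $ i" using ij u colV[OF ij(2)] by auto
    also have "\<dots> = (U * mat_diag k s) $$ (i, j)"
      unfolding mat_diag_mult_right[OF U] using ij by (simp add: U_def)
    finally show "(G * V) $$ (i, j) = (U * mat_diag k s) $$ (i, j)" .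
  qed (use G U V in \<open>auto simp: mat_diag_def\<close>)
  moreover have "V * V\<^sup>T = 1\<^sub>m k"
    using stV V by (intro mat_mult_left_right_inverse[of "V\<^sup>T" k V]) (auto simp: stiefel_def)
  moreover have "G = (G * V) * V\<^sup>T"
    using G V \<open>V * V\<^sup>T = 1\<^sub>m k\<close> by (simp add: assoc_mult_mat[of G n k V k "V\<^sup>T" k])
  ultimately have "G = U * mat_diag k s * V\<^sup>T" by simp
  moreover have "0 \<le> s i" for i unfolding s_def using scalar_prod_self_nonneg by simp
  ultimately have "compact_svd n k G U s V"
    unfolding compact_svd_def by (intro conjI stU stV allI impI)
  moreover have "\<forall>i j. i \<le> j \<and> j < k \<longrightarrow> s j \<le> s i" by (intro allI impI decreasing) auto
  ultimately show ?thesis by (intro exI conjI)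
qed

section \<open>Orthonormal frames and the subspaces they span\<close>

lemma mem_col_space_iff:
  assumes "X \<in> carrier_mat n k"
  shows "y \<in> vec_space.col_space n (X :: real mat) \<longleftrightarrow> (\<exists>x\<in>carrier_vec k. y = X *\<^sub>v x)"
  using assms by (auto simp: vec_space.col_space_eq[OF assms])

lemma col_space_mult_subset:
  assumes X: "(X :: real mat) \<in> carrier_mat n k" and M: "M \<in> carrier_mat k m"
  shows "vec_space.col_space n (X * M) \<subseteq> vec_space.col_space n X"
proof
  fix y assume "y \<in> vec_space.col_space n (X * M)"
  then obtain x where x: "x \<in> carrier_vec m" "y = (X * M) *\<^sub>v x"
    using mem_col_space_iff[of "X * M" n m y] X M by auto
  then have "y = X *\<^sub>v (M *\<^sub>v x)" using X M by simp
  then show "y \<in> vec_space.col_space n X"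
    using mem_col_space_iff[OF X] M x by auto
qed

lemma stiefel_projection_absorb:
  assumes X: "X \<in> stiefel n k" and Z: "Z \<in> carrier_mat n m"
    and sub: "vec_space.col_space n Z \<subseteq> vec_space.col_space n X"
  shows "X * X\<^sup>T * Z = Z"
proof (rule eq_matI)
  have Xc: "X \<in> carrier_mat n k" and XX: "X\<^sup>T * X = 1\<^sub>m k" using X by (auto simp: stiefel_def)
  fix i j assume "i < dim_row Z" "j < dim_col Z"
  then have ij: "i < n" "j < m" using Z by auto
  have "col Z j = Z *\<^sub>v unit_vec m j" 
    by (rule eq_vecI) (use Z ij in auto)
  then have "col Z j \<in> vec_space.col_space n Z"
    using mem_col_space_iff[OF Z, of "col Z j"] by (intro iffD2[OF mem_col_space_iff[OF Z]]) auto
  then obtain x where x: "x \<in> carrier_vec k" "col Z j = X *\<^sub>v x"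
    using sub mem_col_space_iff[OF Xc] by blast
  have "(X * X\<^sup>T) *\<^sub>v col Z j = X *\<^sub>v ((X\<^sup>T * X) *\<^sub>v x)"
    unfolding x(2) using Xc x(1)
    by (simp add: assoc_mult_mat_vec[of X n k "X\<^sup>T" n] assoc_mult_mat_vec[of "X\<^sup>T" k n X k])
  also have "\<dots> = col Z j" using XX x by simp
  finally have fixed: "(X * X\<^sup>T) *\<^sub>v col Z j = col Z j" .
  have entry: "(P * Z) $$ (i, j) = (P *\<^sub>v col Z j) $ i" if "P \<in> carrier_mat n n" for P
    using that Z ij by simp
  have "(X * X\<^sup>T * Z) $$ (i, j) = ((X * X\<^sup>T) *\<^sub>v col Z j) $ i"
    using Xc by (intro entry) auto
  also have "\<dots> = col Z j $ i" by (simp only: fixed)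
  also have "\<dots> = Z $$ (i, j)" using Z ij by simp
  finally show "(X * X\<^sup>T * Z) $$ (i, j) = Z $$ (i, j)" .
qed (use X Z in \<open>auto simp: stiefel_def\<close>)

text \<open>
  Each of the two projectors fixes the columns of the other frame, so their product, taken in
  either order, is one of them; transposing identifies the two.
\<close>

lemma projector_unique:
  assumes "represents n k X W" "represents n k X' W"
  shows "X * X\<^sup>T = X' * X'\<^sup>T"
proof -
  have X: "X \<in> stiefel n k" "X' \<in> stiefel n k" and Xc: "X \<in> carrier_mat n k" "X' \<in> carrier_mat n k"
    using assms by (auto simp: represents_def stiefel_def)
  have abs: "X * X\<^sup>T * X' = X'" "X' * X'\<^sup>T * X = X"
    by (rule stiefel_projection_absorb[OF X(1) Xc(2)], use assms in \<open>simp add: represents_def\<close>)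
      (rule stiefel_projection_absorb[OF X(2) Xc(1)], use assms in \<open>simp add: represents_def\<close>)
  have "X' * X'\<^sup>T = (X * X\<^sup>T * X') * X'\<^sup>T" by (simp only: abs(1))
  also have "\<dots> = (X * X\<^sup>T) * (X' * X'\<^sup>T)"
    by (rule assoc_mult_mat[of _ n n _ k _ n]) (use Xc in auto)
  also have "\<dots> = ((X' * X'\<^sup>T) * (X * X\<^sup>T))\<^sup>T"
    using Xc by (simp add: transpose_mult[of _ n n _ n] transpose_mult[of _ n k _ n])
  also have "(X' * X'\<^sup>T) * (X * X\<^sup>T) = (X' * X'\<^sup>T * X) * X\<^sup>T"
    by (rule assoc_mult_mat[of _ n n _ k _ n, symmetric]) (use Xc in auto)
  also have "\<dots> = X * X\<^sup>T" by (simp only: abs(2))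
  also have "(X * X\<^sup>T)\<^sup>T = X * X\<^sup>T" using Xc by (simp add: transpose_mult[of _ n k _ n])
  finally show ?thesis ..
qed

lemma inner_projector:
  assumes X: "X \<in> carrier_mat n k" and x: "x \<in> carrier_vec n" and y: "y \<in> carrier_vec n"
  shows "x \<bullet> ((X * X\<^sup>T) *\<^sub>v y) = (\<Sum>a<k. (x \<bullet> col X a) * (col X a \<bullet> (y :: real vec)))"
proof -
  have "x \<bullet> ((X * X\<^sup>T) *\<^sub>v y) = x \<bullet> (X *\<^sub>v (X\<^sup>T *\<^sub>v y))"
    using X y by (simp add: assoc_mult_mat_vec[of X n k "X\<^sup>T" n])
  also have "\<dots> = (X\<^sup>T *\<^sub>v x) \<bullet> (X\<^sup>T *\<^sub>v y)"
    using transpose_vec_mult_scalar[OF X, of "X\<^sup>T *\<^sub>v y" x] X x y by simp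
  also have "\<dots> = (\<Sum>a<k. (col X a \<bullet> x) * (col X a \<bullet> y))"
    using X unfolding scalar_prod_def[of "X\<^sup>T *\<^sub>v x"] by (intro sum.cong) auto
  also have "\<dots> = (\<Sum>a<k. (x \<bullet> col X a) * (col X a \<bullet> y))"
  proof (intro sum.cong refl)
    fix a assume "a \<in> {..<k}"
    have "col X a \<bullet> x = x \<bullet> col X a" using X x by (intro comm_scalar_prod[of _ n]) auto
    then show "(col X a \<bullet> x) * (col X a \<bullet> y) = (x \<bullet> col X a) * (col X a \<bullet> y)" by simp
  qed
  finally show ?thesis .
qed

lemma projection_norm_eq:
  assumes X: "X \<in> carrier_mat n k" and x: "x \<in> carrier_vec n"
  shows "(\<Sum>a<k. (x \<bullet> col X a)\<^sup>2) = x \<bullet> ((X * X\<^sup>T) *\<^sub>v (x :: real vec))"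
proof -
  have "col X a \<in> carrier_vec n" for a using X by (intro carrier_vecI) simp
  then have "(x \<bullet> col X a)\<^sup>2 = (x \<bullet> col X a) * (col X a \<bullet> x)" for a
    using comm_scalar_prod[of x n "col X a"] x by (simp add: power2_eq_square)
  then show ?thesis unfolding inner_projector[OF X x x] by simp
qed

lemma stiefel_mult:
  assumes X: "X \<in> stiefel n k" and V: "V \<in> stiefel k k"
  shows "X * V \<in> stiefel n k" "V * V\<^sup>T = 1\<^sub>m k" "(X * V) * (X * V)\<^sup>T = X * X\<^sup>T"
proof -
  have Xc: "X \<in> carrier_mat n k" "X\<^sup>T * X = 1\<^sub>m k" and Vc: "V \<in> carrier_mat k k" "V\<^sup>T * V = 1\<^sub>m k"
    using X V by (auto simp: stiefel_def)
  have t: "(X * V)\<^sup>T = V\<^sup>T * X\<^sup>T" using Xc Vc by (simp add: transpose_mult[of _ n k _ k])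
  have "(X * V)\<^sup>T * (X * V) = V\<^sup>T * ((X\<^sup>T * X) * V)"
    unfolding t using Xc(1) Vc(1)
    by (simp add: assoc_mult_mat[of _ k k _ n _ k] assoc_mult_mat[of _ k n _ k _ k])
  then show "X * V \<in> stiefel n k" using Xc Vc by (simp add: stiefel_def)
  show VV: "V * V\<^sup>T = 1\<^sub>m k"
    using Vc by (intro mat_mult_left_right_inverse[of "V\<^sup>T" k V]) auto
  have "(X * V) * (X * V)\<^sup>T = X * ((V * V\<^sup>T) * X\<^sup>T)"
    unfolding t using Xc(1) Vc(1)
    by (simp add: assoc_mult_mat[of _ n k _ k _ n] assoc_mult_mat[of _ k k _ k _ n])
  then show "(X * V) * (X * V)\<^sup>T = X * X\<^sup>T" using VV Xc by simp
qed

section \<open>Coordinates with respect to the eigenbasis\<close>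

locale orthonormal_eigenbasis =
  fixes n :: nat and A :: "real mat" and l :: "nat \<Rightarrow> real" and v :: "nat \<Rightarrow> real vec"
  assumes A: "A \<in> carrier_mat n n" and A_sym: "A\<^sup>T = A" and eig: "eigensystem n A l v"
begin

lemma v_carrier: "i \<in> {1..n} \<Longrightarrow> v i \<in> carrier_vec n"
  using eig unfolding eigensystem_def by auto

lemma v_orthonormal: "i \<in> {1..n} \<Longrightarrow> j \<in> {1..n} \<Longrightarrow> v i \<bullet> v j = (if i = j then 1 else 0)"
  using eig unfolding eigensystem_def by auto

lemma l_decreasing: "1 \<le> i \<Longrightarrow> i \<le> j \<Longrightarrow> j \<le> n \<Longrightarrow> l j \<le> l i"
  using eig unfolding eigensystem_def by auto

definition eigenmat :: "nat \<Rightarrow> real mat" where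
  "eigenmat m = mat n m (\<lambda>(i, j). v (Suc j) $ i)"

lemma eigenmat_carrier: "eigenmat m \<in> carrier_mat n m"
  unfolding eigenmat_def by simp

lemma col_eigenmat: "m \<le> n \<Longrightarrow> j < m \<Longrightarrow> col (eigenmat m) j = v (Suc j)"
  using v_carrier[of "Suc j"] unfolding eigenmat_def by (intro eq_vecI) auto

lemma eigenmat_stiefel: "m \<le> n \<Longrightarrow> eigenmat m \<in> stiefel n m"
  unfolding stiefel_iff by (auto simp: eigenmat_carrier col_eigenmat v_orthonormal)

lemma parseval:
  assumes x: "x \<in> carrier_vec n" and y: "y \<in> carrier_vec n"
  shows "(\<Sum>q = 1..n. (v q \<bullet> x) * (v q \<bullet> y)) = x \<bullet> y"
proof -
  have "eigenmat n * (eigenmat n)\<^sup>T = 1\<^sub>m n"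
    using eigenmat_stiefel[of n] eigenmat_carrier[of n]
    by (intro mat_mult_left_right_inverse[of "(eigenmat n)\<^sup>T" n "eigenmat n"]) (auto simp: stiefel_def)
  then have "x \<bullet> y = x \<bullet> ((eigenmat n * (eigenmat n)\<^sup>T) *\<^sub>v y)" using y by simp
  also have "\<dots> = (\<Sum>a<n. (x \<bullet> v (Suc a)) * (v (Suc a) \<bullet> y))"
    unfolding inner_projector[OF eigenmat_carrier x y] by (simp add: col_eigenmat)
  also have "\<dots> = (\<Sum>a<n. (v (Suc a) \<bullet> x) * (v (Suc a) \<bullet> y))"
  proof (intro sum.cong refl)
    fix a assume "a \<in> {..<n}"
    then have "x \<bullet> v (Suc a) = v (Suc a) \<bullet> x"
      using x v_carrier[of "Suc a"] by (intro comm_scalar_prod[of _ n]) auto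
    then show "(x \<bullet> v (Suc a)) * (v (Suc a) \<bullet> y) = (v (Suc a) \<bullet> x) * (v (Suc a) \<bullet> y)" by simp
  qed
  also have "\<dots> = (\<Sum>q = 1..n. (v q \<bullet> x) * (v q \<bullet> y))"
    by (simp add: sum.atLeast1_atMost_eq)
  finally show ?thesis ..
qed

lemma inner_eigenvector_mult:
  assumes q: "q \<in> {1..n}" and x: "x \<in> carrier_vec n"
  shows "v q \<bullet> (A *\<^sub>v x) = l q * (v q \<bullet> x)"
proof -
  have "v q \<bullet> (A *\<^sub>v x) = (A\<^sup>T *\<^sub>v v q) \<bullet> x"
    using transpose_vec_mult_scalar[OF A x v_carrier[OF q]] by simp
  also have "A\<^sup>T *\<^sub>v v q = l q \<cdot>\<^sub>v v q"
    using eig q unfolding A_sym eigensystem_def by auto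
  finally show ?thesis using x v_carrier[OF q] by simp
qed

end

text \<open>
  This is the column form of \<open>G V = U \<Sigma>\<close>.
\<close>

lemma singular_vectors_image:
  assumes svd: "compact_svd n k G U s V" and G: "G \<in> carrier_mat n k" and a: "a < k"
  shows "G *\<^sub>v col V a = s a \<cdot>\<^sub>v col U a"
proof -
  have U: "U \<in> carrier_mat n k" and V: "V \<in> carrier_mat k k" "V\<^sup>T * V = 1\<^sub>m k"
    and Geq: "G = U * mat_diag k s * V\<^sup>T"
    using svd by (auto simp: compact_svd_def stiefel_def)
  have "G * V = U * mat_diag k s * (V\<^sup>T * V)"
    unfolding Geq by (rule assoc_mult_mat[of _ n k _ k _ k]) (use U V in auto)
  then have GV: "G * V = U * mat_diag k s" 
    unfolding V(2) right_mult_one_mat[OF mult_carrier_mat[OF U mat_diag_dim]] .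
  have "G *\<^sub>v col V a = col (G * V) a"
    using G V(1) a by (intro eq_vecI) auto
  also have "\<dots> = s a \<cdot>\<^sub>v col U a"
    unfolding GV mat_diag_mult_right[OF U] using U a by (intro eq_vecI) auto
  finally show ?thesis .
qed

lemma gr_exp_eq:
  assumes "G \<in> carrier_mat n k" "k \<le> n"
  obtains U s V where "compact_svd n k G U s V"
    "gr_exp n k X G = vec_space.col_space n
       (X * V * mat_diag k (\<lambda>i. cos (s i)) + U * mat_diag k (\<lambda>i. sin (s i)))"
proof -
  define t where "t = (SOME (U, s, V). compact_svd n k G U s V)"
  obtain U s V where t: "t = (U, s, V)" by (cases t) auto
  have "\<exists>t. (case t of (U, s, V) \<Rightarrow> compact_svd n k G U s V)"
    using compact_svd_exists[OF assms] by auto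
  from someI_ex[OF this] have "compact_svd n k G U s V"
    unfolding t_def[symmetric] t by simp
  then show ?thesis
    by (rule that) (simp add: gr_exp_def t_def[symmetric] t)
qed

context orthonormal_eigenbasis
begin

definition defect_of :: "nat \<Rightarrow> real mat \<Rightarrow> real" where
  "defect_of k X = (\<Sum>a<k. \<Sum>p = k + 1..n. (v p \<bullet> col X a)\<^sup>2)"

text \<open>
  The defect depends only on the projector, because it equals the sum of \<open>v\<^sub>p \<bullet> (X X\<^sup>T v\<^sub>p)\<close>; this frees it from the
  choice of representatives, which the iteration changes arbitrarily in every step.
\<close>

lemma defect_of_cong:
  assumes X: "X \<in> carrier_mat n k" and X': "X' \<in> carrier_mat n k" and eq: "X * X\<^sup>T = X' * X'\<^sup>T"
  shows "defect_of k X = defect_of k X'"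
proof -
  have "defect_of k Z = (\<Sum>p = k + 1..n. v p \<bullet> ((Z * Z\<^sup>T) *\<^sub>v v p))" if Z: "Z \<in> carrier_mat n k" for Z
  proof -
    have "defect_of k Z = (\<Sum>p = k + 1..n. \<Sum>a<k. (v p \<bullet> col Z a)\<^sup>2)"
      unfolding defect_of_def by (rule sum.swap)
    then show ?thesis using projection_norm_eq[OF Z] v_carrier by simp
  qed
  then show ?thesis using X X' eq by simp
qed

lemma defect_of_represents:
  assumes "represents n k X W" "represents n k X' W"
  shows "defect_of k X = defect_of k X'"
  using assms projector_unique[OF assms]
  by (intro defect_of_cong) (auto simp: represents_def stiefel_def)

end

locale spectral_gap = orthonormal_eigenbasis +
  fixes k :: nat
  assumes k: "1 \<le> k" "k < n" and gap: "l (k + 1) < l k"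
begin

lemma split_indices: "{1..k} \<union> {k + 1..n} = {1..n}"
  using k by auto

lemma gap_splitting_coordinates:
  assumes "Y \<in> stiefel n k"
  shows "gap_splitting {1..k} {k + 1..n} {..<k} (\<lambda>a q. v q \<bullet> col Y a) (\<lambda>q. l q - l k)
    (l 1 - l k) (l k - l n) (l k - l (k + 1))"
proof
  fix a b assume ab: "a \<in> {..<k}" "b \<in> {..<k}"
  have Y: "Y \<in> carrier_mat n k" using assms by (simp add: stiefel_def)
  have "(\<Sum>q\<in>{1..n}. (v q \<bullet> col Y a) * (v q \<bullet> col Y b)) = col Y a \<bullet> col Y b"
    using Y ab by (intro parseval carrier_vecI) auto
  then show "(\<Sum>q\<in>{1..k} \<union> {k + 1..n}. (v q \<bullet> col Y a) * (v q \<bullet> col Y b)) = (if a = b then 1 else 0)"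
    unfolding split_indices using assms ab by (simp add: stiefel_iff)
next
  fix j assume "j \<in> {1..k}"
  then show "0 \<le> l j - l k \<and> l j - l k \<le> l 1 - l k"
    using l_decreasing[of j k] l_decreasing[of 1 j] k by auto
next
  fix p assume "p \<in> {k + 1..n}"
  then show "- (l k - l n) \<le> l p - l k \<and> l p - l k \<le> - (l k - l (k + 1))"
    using l_decreasing[of p n] l_decreasing[of "k + 1" p] by auto
qed (use k l_decreasing[of 1 k] l_decreasing[of k n] gap in auto)

lemma spread_pos: "0 < l 1 - l n"
  using l_decreasing[of 1 k] l_decreasing[of "k + 1" n] gap k by auto

text \<open>
  The coordinate computation applies to the frame \<open>Y = X V\<close>, which spans the same subspace as \<open>X\<close>. The matrix
  \<open>Z\<close> in the definition of the exponential map is again an orthonormal frame, so its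
  defect is the defect of the next iterate.
\<close>

lemma defect_step:
  assumes X: "X \<in> stiefel n k" and \<gamma>: "\<gamma> = 2 * (l 1 - l n)"
    and X': "represents n k X' (gr_exp n k X ((- (1 / \<gamma>)) \<cdot>\<^sub>m rgrad n A X))"
    and small: "defect_of k X \<le> 5 / 8"
  shows "defect_of k X' \<le> (1 - 3 * (l k - l (k + 1)) / (1600 * (l 1 - l n))) * defect_of k X"
proof -
  define L where "L = l 1 - l n"
  have L: "0 < L" using spread_pos by (simp add: L_def)
  have Xc: "X \<in> carrier_mat n k" using X by (simp add: stiefel_def)
  define G where "G = (- (1 / \<gamma>)) \<cdot>\<^sub>m rgrad n A X"
  have G: "G \<in> carrier_mat n k" unfolding G_def rgrad_def using Xc A by auto
  obtain U s V where svd: "compact_svd n k G U s V" and exp_eq: "gr_exp n k X G = vec_space.col_space n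
       (X * V * mat_diag k (\<lambda>i. cos (s i)) + U * mat_diag k (\<lambda>i. sin (s i)))"
    using gr_exp_eq[OF G, of X] k by auto
  have U: "U \<in> stiefel n k" and V: "V \<in> stiefel k k" and s: "\<And>a. a < k \<Longrightarrow> 0 \<le> s a"
    using svd by (auto simp: compact_svd_def)
  have Uc: "U \<in> carrier_mat n k" and Vc: "V \<in> carrier_mat k k"
    using U V by (auto simp: stiefel_def)
  define Y where "Y = X * V"
  have Y: "Y \<in> stiefel n k" and YY: "Y * Y\<^sup>T = X * X\<^sup>T"
    using stiefel_mult[OF X V] by (simp_all add: Y_def)
  have Yc: "Y \<in> carrier_mat n k" using Y by (simp add: stiefel_def)
  have colY: "col Y a \<in> carrier_vec n" for a using Yc by (intro carrier_vecI) simp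
  have colU: "col U a \<in> carrier_vec n" for a using Uc by (intro carrier_vecI) simp
  define y where "y a q = v q \<bullet> col Y a" for a q
  define u where "u a q = v q \<bullet> col U a" for a q
  define \<mu> where "\<mu> q = l q - l k" for q
  interpret gap_splitting "{1..k}" "{k + 1..n}" "{..<k}" y \<mu> "l 1 - l k" "l k - l n" "l k - l (k + 1)"
    unfolding y_def[abs_def] \<mu>_def[abs_def] by (rule gap_splitting_coordinates[OF Y])
  have defect_eq': "defect = defect_of k X"
    using defect_of_cong[OF Yc Xc YY] unfolding defect_eq defect_of_def y_def by simp
  have small': "defect \<le> 5 / 8" using small by (simp only: defect_eq')
  have u_orthonormal: "(\<Sum>q\<in>{1..k} \<union> {k + 1..n}. u a q * u b q) = (if a = b then 1 else 0)"
    if "a < k" "b < k" for a b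
    unfolding split_indices u_def parseval[OF colU colU] using U that by (simp add: stiefel_iff)
  \<comment> \<open>In eigencoordinates A is diagonal, and the shift of the spectrum drops out since (I - Y Y^T) Y = 0.\<close>
  have tangent: "L * (s a * u a q) = grad a q" if a: "a < k" and q: "q \<in> {1..n}" for a q
  proof -
    have AY: "A *\<^sub>v col Y a \<in> carrier_vec n" using A colY[of a] by auto
    have YYc: "Y * Y\<^sup>T \<in> carrier_mat n n" using Yc by auto
    have "L \<cdot>\<^sub>v (s a \<cdot>\<^sub>v col U a) = L \<cdot>\<^sub>v (G *\<^sub>v col V a)"
      using singular_vectors_image[OF svd G a] by simp
    also have "G = (1 / L) \<cdot>\<^sub>m ((1\<^sub>m n - Y * Y\<^sup>T) * A * X)"
      unfolding G_def rgrad_def YY \<gamma> L_def[symmetric] using L by (intro eq_matI) auto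
    also have "L \<cdot>\<^sub>v ((1 / L) \<cdot>\<^sub>m ((1\<^sub>m n - Y * Y\<^sup>T) * A * X) *\<^sub>v col V a)
        = ((1\<^sub>m n - Y * Y\<^sup>T) * A * X) *\<^sub>v col V a"
    proof -
      have "(1\<^sub>m n - Y * Y\<^sup>T) * A * X \<in> carrier_mat n k"
        by (intro mult_carrier_mat[of _ n n] minus_carrier_mat YYc A Xc)
      then show ?thesis using L Vc a by (intro eq_vecI) auto
    qed
    also have "\<dots> = (1\<^sub>m n - Y * Y\<^sup>T) *\<^sub>v (A *\<^sub>v (X *\<^sub>v col V a))"
    proof -
      have N: "1\<^sub>m n - Y * Y\<^sup>T \<in> carrier_mat n n" by (rule minus_carrier_mat[OF YYc])
      have c: "col V a \<in> carrier_vec k" "X *\<^sub>v col V a \<in> carrier_vec n" using Xc Vc a by auto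
      show ?thesis
        unfolding assoc_mult_mat_vec[OF mult_carrier_mat[OF N A] Xc c(1)] assoc_mult_mat_vec[OF N A c(2)] ..
    qed
    also have "X *\<^sub>v col V a = col Y a"
      unfolding Y_def using Xc Vc a by (intro eq_vecI) auto
    also have "(1\<^sub>m n - Y * Y\<^sup>T) *\<^sub>v (A *\<^sub>v col Y a) = A *\<^sub>v col Y a - (Y * Y\<^sup>T) *\<^sub>v (A *\<^sub>v col Y a)"
      using YYc AY by (simp add: minus_mult_distrib_mat_vec[of _ n n])
    finally have eq: "L \<cdot>\<^sub>v (s a \<cdot>\<^sub>v col U a) = A *\<^sub>v col Y a - (Y * Y\<^sup>T) *\<^sub>v (A *\<^sub>v col Y a)" .
    have vq: "v q \<in> carrier_vec n" using q by (rule v_carrier)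
    have "L * (s a * u a q) = v q \<bullet> (L \<cdot>\<^sub>v (s a \<cdot>\<^sub>v col U a))"
      using vq colU[of a] by (simp add: u_def)
    also have "\<dots> = v q \<bullet> (A *\<^sub>v col Y a) - v q \<bullet> ((Y * Y\<^sup>T) *\<^sub>v (A *\<^sub>v col Y a))"
      unfolding eq using vq AY YYc by (intro scalar_prod_minus_distrib[of _ n]) auto
    also have "v q \<bullet> (A *\<^sub>v col Y a) = l q * y a q"
      using inner_eigenvector_mult[OF q colY] by (simp add: y_def)
    also have "v q \<bullet> ((Y * Y\<^sup>T) *\<^sub>v (A *\<^sub>v col Y a)) = (\<Sum>b<k. y b q * (\<Sum>r = 1..n. y b r * (l r * y a r)))"
      unfolding inner_projector[OF Yc vq AY]
    proof (intro sum.cong refl)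
      fix b
      have "col Y b \<bullet> (A *\<^sub>v col Y a) = (\<Sum>r = 1..n. y b r * (v r \<bullet> (A *\<^sub>v col Y a)))"
        unfolding parseval[OF colY AY, symmetric] y_def ..
      also have "\<dots> = (\<Sum>r = 1..n. y b r * (l r * y a r))"
        by (intro sum.cong refl) (simp add: inner_eigenvector_mult[OF _ colY] y_def)
      finally show "v q \<bullet> col Y b * (col Y b \<bullet> (A *\<^sub>v col Y a)) = y b q * (\<Sum>r = 1..n. y b r * (l r * y a r))"
        by (simp add: y_def)
    qed
    also have "\<dots> = (\<Sum>r = 1..n. proj q r * (l r * y a r))"
      using proj_apply[of q "\<lambda>r. l r * y a r" "{1..n}"] by (simp add: mult.commute)
    also have "l q * y a q - \<dots> = grad a q"
    proof -
      have "(\<Sum>r = 1..n. proj q r * y a r) = (\<Sum>b<k. (\<Sum>r = 1..n. y b r * y a r) * y b q)"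
        by (rule proj_apply)
      also have "\<dots> = (\<Sum>b<k. if b = a then y a q else 0)"
        using orthonormal a unfolding split_indices by (intro sum.cong refl) auto
      finally have "(\<Sum>r = 1..n. proj q r * y a r) = y a q" using a by simp
      then have "(\<Sum>r = 1..n. proj q r * (l k * y a r)) = l k * y a q"
        by (simp add: mult.left_commute flip: sum_distrib_left)
      then show ?thesis
        unfolding grad_def split_indices \<mu>_def left_diff_distrib right_diff_distrib sum_subtractf by simp
    qed
    finally show ?thesis .
  qed
  define Z where "Z = Y * mat_diag k (\<lambda>i. cos (s i)) + U * mat_diag k (\<lambda>i. sin (s i))"
  have Zc: "Z \<in> carrier_mat n k" using Yc Uc unfolding Z_def by auto
  have colZ: "col Z a = cos (s a) \<cdot>\<^sub>v col Y a + sin (s a) \<cdot>\<^sub>v col U a" if "a < k" for a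
    unfolding Z_def mat_diag_mult_right[OF Yc] mat_diag_mult_right[OF Uc]
    using that Yc Uc by (intro eq_vecI) auto
  have Y_U: "sin (s a) * (col Y b \<bullet> col U a) = 0" if "a < k" "b < k" for a b
  proof -
    have "L * s a * (col Y b \<bullet> col U a) = (\<Sum>q\<in>{1..n}. y b q * (L * (s a * u a q)))"
      unfolding parseval[OF colY colU, symmetric] sum_distrib_left
      by (intro sum.cong refl) (simp add: y_def u_def)
    also have "\<dots> = (\<Sum>q\<in>{1..n}. y b q * grad a q)"
      using that by (intro sum.cong refl) (simp add: tangent)
    also have "\<dots> = 0" using grad_orthogonal[of b a] that unfolding split_indices by simp
    finally show ?thesis using L by auto
  qed
  have U_Y: "col U a \<bullet> col Y b = col Y b \<bullet> col U a" for a b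
    using colY colU by (rule comm_scalar_prod[rotated])
  have Z: "Z \<in> stiefel n k"
    unfolding stiefel_iff
  proof (intro conjI allI impI Zc)
    fix a b assume ab: "a < k" "b < k"
    have "col Z a \<bullet> col Z b = cos (s a) * cos (s b) * (col Y a \<bullet> col Y b)
        + cos (s a) * (sin (s b) * (col Y a \<bullet> col U b)) + cos (s b) * (sin (s a) * (col Y b \<bullet> col U a))
        + sin (s a) * sin (s b) * (col U a \<bullet> col U b)"
      unfolding colZ[OF ab(1)] colZ[OF ab(2)] using colY colU Yc Uc
      by (simp add: scalar_prod_add_distrib[of _ n] add_scalar_prod_distrib[of _ n] U_Y algebra_simps)
    also have "\<dots> = (if a = b then 1 else 0)"
      unfolding Y_U[OF ab] Y_U[OF ab(2) ab(1)] using Y U ab sin_cos_squared_add[of "s a"]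
      by (auto simp: stiefel_iff power2_eq_square)
    finally show "col Z a \<bullet> col Z b = (if a = b then 1 else 0)" .
  qed
  have "represents n k Z (gr_exp n k X G)"
    using Z unfolding represents_def exp_eq Z_def Y_def by simp
  then have "defect_of k X' = defect_of k Z"
    using X' unfolding G_def[symmetric] by (intro defect_of_represents)
  also have "\<dots> = (\<Sum>a<k. \<Sum>p = k + 1..n. (cos (s a) * y a p + sin (s a) * u a p)\<^sup>2)"
    unfolding defect_of_def
  proof (intro sum.cong refl)
    fix a p assume "a \<in> {..<k}" "p \<in> {k + 1..n}"
    then show "(v p \<bullet> col Z a)\<^sup>2 = (cos (s a) * y a p + sin (s a) * u a p)\<^sup>2"
      using colY colU v_carrier[of p]
      by (simp add: colZ scalar_prod_add_distrib[of _ n] y_def u_def)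
  qed
  also have "\<dots> \<le> (1 - 3 * (l k - l (k + 1)) / (1600 * ((l 1 - l k) + (l k - l n)))) * defect"
  proof (rule geodesic_step)
    fix a q assume "a \<in> {..<k}" "q \<in> {1..k} \<union> {k + 1..n}"
    then show "(l 1 - l k + (l k - l n)) * (s a * u a q) = grad a q"
      using tangent[of a q] unfolding split_indices by (simp add: L_def)
  qed (use u_orthonormal s spread_pos small' in auto)
  also have "(l 1 - l k) + (l k - l n) = l 1 - l n" by simp
  finally show ?thesis unfolding defect_eq' .
qed

text \<open>
  This quantitative form of Ky Fan's inequality follows from comparing, in the trace
  \<open>\<Sum> \<lambda>\<^sub>q \<Pi>\<^sub>q\<^sub>q\<close>, the eigenvalues in \<open>J\<close> with \<open>\<lambda>\<^sub>k\<close> and those in \<open>Q\<close> with \<open>\<lambda>\<^sub>k\<^sub>+\<^sub>1\<close>.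
\<close>

lemma objective_gap_ge:
  assumes X: "represents n k (rep n k W) W"
  shows "(l k - l (k + 1)) * defect_of k (rep n k W) \<le> objective n k A W - objective_min k l"
proof -
  define Y where "Y = rep n k W"
  have Y: "Y \<in> stiefel n k" using X by (simp add: Y_def represents_def)
  have Yc: "Y \<in> carrier_mat n k" using Y by (simp add: stiefel_def)
  have colY: "col Y a \<in> carrier_vec n" for a using Yc by (intro carrier_vecI) simp
  define y where "y a q = v q \<bullet> col Y a" for a q
  define \<mu> where "\<mu> q = l q - l k" for q
  interpret gap_splitting "{1..k}" "{k + 1..n}" "{..<k}" y \<mu> "l 1 - l k" "l k - l n" "l k - l (k + 1)"
    unfolding y_def[abs_def] \<mu>_def[abs_def] by (rule gap_splitting_coordinates[OF Y])
  have defect_eq': "defect = defect_of k Y"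
    unfolding defect_eq defect_of_def y_def ..
  have "objective n k A W = - (\<Sum>a<k. col Y a \<bullet> (A *\<^sub>v col Y a))"
    unfolding objective_def Y_def[symmetric] mtrace_def
  proof (intro arg_cong[of _ _ uminus] sum.cong)
    fix a assume a: "a \<in> {..<k}"
    have "Y\<^sup>T * A * Y = Y\<^sup>T * (A * Y)" using Yc A by (intro assoc_mult_mat[of _ k n _ n _ k]) auto
    then have "(Y\<^sup>T * A * Y) $$ (a, a) = col Y a \<bullet> col (A * Y) a" using Yc A a by simp
    also have "col (A * Y) a = A *\<^sub>v col Y a" using Yc A a by (intro eq_vecI) auto
    finally show "(Y\<^sup>T * A * Y) $$ (a, a) = col Y a \<bullet> (A *\<^sub>v col Y a)" .
  qed (use Yc in auto)
  also have "(\<Sum>a<k. col Y a \<bullet> (A *\<^sub>v col Y a)) = (\<Sum>a<k. \<Sum>q = 1..n. l q * (y a q)\<^sup>2)"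
  proof (intro sum.cong refl)
    fix a
    have "A *\<^sub>v col Y a \<in> carrier_vec n" using A colY[of a] by auto
    then have "col Y a \<bullet> (A *\<^sub>v col Y a) = (\<Sum>q = 1..n. (v q \<bullet> col Y a) * (v q \<bullet> (A *\<^sub>v col Y a)))"
      by (rule parseval[OF colY, symmetric])
    also have "\<dots> = (\<Sum>q = 1..n. l q * (y a q)\<^sup>2)"
      by (intro sum.cong refl) (simp add: inner_eigenvector_mult[OF _ colY] y_def power2_eq_square)
    finally show "col Y a \<bullet> (A *\<^sub>v col Y a) = (\<Sum>q = 1..n. l q * (y a q)\<^sup>2)" .
  qed
  also have "\<dots> = (\<Sum>q = 1..n. l q * proj q q)"
    by (subst sum.swap) (simp add: proj_def power2_eq_square sum_distrib_left)
  also have "\<dots> = (\<Sum>q = 1..n. \<mu> q * proj q q) + l k * k"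
    using trace_proj unfolding split_indices \<mu>_def
    by (simp add: left_diff_distrib sum_subtractf flip: sum_distrib_left)
  also have "(\<Sum>q = 1..n. \<mu> q * proj q q) = (\<Sum>j = 1..k. \<mu> j * proj j j) + (\<Sum>p = k + 1..n. \<mu> p * proj p p)"
    using sum_J_Q[of "\<lambda>q. \<mu> q * proj q q"] unfolding split_indices .
  finally have obj: "objective n k A W
      = - ((\<Sum>j = 1..k. \<mu> j * proj j j) + (\<Sum>p = k + 1..n. \<mu> p * proj p p) + l k * k)" .
  have "(\<Sum>j = 1..k. \<mu> j * proj j j) \<le> (\<Sum>j = 1..k. \<mu> j)"
  proof (rule sum_mono)
    fix j assume j: "j \<in> {1..k}"
    then have "proj j j \<le> 1" using coproj_diag_nonneg[of j] unfolding coproj_def by auto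
    then show "\<mu> j * proj j j \<le> \<mu> j" using upper[OF j] by (simp add: mult_left_le)
  qed
  also have "\<dots> = (\<Sum>j = 1..k. l j) - l k * k"
    by (simp add: \<mu>_def sum_subtractf)
  finally have J: "(\<Sum>j = 1..k. \<mu> j * proj j j) \<le> (\<Sum>j = 1..k. l j) - l k * k" .
  have "(\<Sum>p = k + 1..n. \<mu> p * proj p p) \<le> (\<Sum>p = k + 1..n. - (l k - l (k + 1)) * proj p p)"
    using lower by (intro sum_mono mult_right_mono proj_diag_nonneg) auto
  also have "\<dots> = - ((l k - l (k + 1)) * defect)"
    by (simp only: defect_def mult_minus_left sum_negf sum_distrib_left[symmetric])
  finally have "(\<Sum>p = k + 1..n. \<mu> p * proj p p) \<le> - ((l k - l (k + 1)) * defect)" .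
  with obj J show ?thesis unfolding objective_min_def defect_eq' Y_def[symmetric] by linarith
qed

section \<open>Principal angles and the distance to the leading eigenspace\<close>

lemma sum_leading_eigenvectors:
  assumes "x \<in> carrier_vec n"
  shows "(\<Sum>a<k. (x \<bullet> col (eigenmat k) a)\<^sup>2) + (\<Sum>p = k + 1..n. (v p \<bullet> x)\<^sup>2) = x \<bullet> x"
proof -
  have "(\<Sum>a<k. (x \<bullet> col (eigenmat k) a)\<^sup>2) = (\<Sum>a<k. (v (Suc a) \<bullet> x)\<^sup>2)"
  proof (intro sum.cong refl)
    fix a assume "a \<in> {..<k}"
    then show "(x \<bullet> col (eigenmat k) a)\<^sup>2 = (v (Suc a) \<bullet> x)\<^sup>2"
      using k assms v_carrier[of "Suc a"] by (simp add: col_eigenmat comm_scalar_prod[of x n])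
  qed
  also have "\<dots> = (\<Sum>q = 1..k. (v q \<bullet> x)\<^sup>2)" by (simp add: sum.atLeast1_atMost_eq)
  also have "\<dots> + (\<Sum>p = k + 1..n. (v p \<bullet> x)\<^sup>2) = (\<Sum>q = 1..n. (v q \<bullet> x)\<^sup>2)"
    unfolding split_indices[symmetric] by (rule sum.union_disjoint[symmetric]) auto
  also have "\<dots> = x \<bullet> x" using parseval[OF assms assms] by (simp add: power2_eq_square)
  finally show ?thesis .
qed

abbreviation "leading_space \<equiv> vspan n (v ` {1..k})"

lemma eigenmat_represents: "represents n k (eigenmat k) leading_space"
proof -
  have "set (cols (eigenmat k)) = col (eigenmat k) ` {0..<k}"
    unfolding cols_def using eigenmat_carrier[of k] by simp
  also have "\<dots> = v ` Suc ` {0..<k}"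
    unfolding image_image using k by (intro image_cong) (auto simp: col_eigenmat)
  also have "Suc ` {0..<k} = {1..k}" by (simp add: image_Suc_atLeastLessThan atLeastLessThanSuc_atLeastAtMost)
  finally have "vec_space.col_space n (eigenmat k) = leading_space"
    by (simp add: vec_space.col_space_def)
  then show ?thesis using eigenmat_stiefel[of k] k by (simp add: represents_def)
qed

text \<open>
  Without defect every column of \<open>X\<close> is a combination of the leading eigenvectors, \<open>X = E M\<close>. As both frames are
  orthonormal, the square matrix \<open>M\<close> is orthogonal and can be inverted by its transpose.
\<close>

lemma subspace_eq_leading_space:
  assumes X: "represents n k X W" and "defect_of k X = 0"
  shows "W = leading_space"
proof -
  define E where "E = eigenmat k"
  have E: "E \<in> stiefel n k" "vec_space.col_space n E = leading_space"
    using eigenmat_represents by (simp_all add: represents_def E_def)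
  have Ec: "E \<in> carrier_mat n k" using E by (simp add: stiefel_def)
  have Xs: "X \<in> stiefel n k" "vec_space.col_space n X = W" using X by (simp_all add: represents_def)
  have Xc: "X \<in> carrier_mat n k" "X\<^sup>T * X = 1\<^sub>m k" using Xs by (auto simp: stiefel_def)
  have zero: "v p \<bullet> col X a = 0" if "a < k" "p \<in> {k + 1..n}" for a p
  proof -
    have "\<forall>a\<in>{..<k}. (\<Sum>p = k + 1..n. (v p \<bullet> col X a)\<^sup>2) = 0"
      using assms(2) unfolding defect_of_def
      by (subst (asm) sum_nonneg_eq_0_iff) (auto intro: sum_nonneg)
    then have "(\<Sum>p = k + 1..n. (v p \<bullet> col X a)\<^sup>2) = 0" using that by blast
    then have "\<forall>p\<in>{k + 1..n}. (v p \<bullet> col X a)\<^sup>2 = 0"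
      by (subst (asm) sum_nonneg_eq_0_iff) auto
    then show ?thesis using that by simp
  qed
  define M where "M = E\<^sup>T * X"
  have M: "M \<in> carrier_mat k k" using Ec Xc by (auto simp: M_def)
  have XE: "E * M = X"
  proof (rule mat_col_eqI)
    fix a assume "a < dim_col X"
    then have a: "a < k" using Xc by simp
    define x where "x = col X a"
    have x: "x \<in> carrier_vec n" unfolding x_def using Xc by (intro carrier_vecI) simp
    define r where "r = x - (E * E\<^sup>T) *\<^sub>v x"
    have EE: "E * E\<^sup>T \<in> carrier_mat n n" using Ec by auto
    have Ex: "(E * E\<^sup>T) *\<^sub>v x \<in> carrier_vec n" using EE x by auto
    have r: "r \<in> carrier_vec n" using x Ex by (simp add: r_def)
    have orth: "v q \<bullet> r = 0" if q: "q \<in> {1..n}" for q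
    proof -
      have vq: "v q \<in> carrier_vec n" using q by (rule v_carrier)
      have "v q \<bullet> ((E * E\<^sup>T) *\<^sub>v x) = (\<Sum>b<k. (v q \<bullet> v (Suc b)) * (v (Suc b) \<bullet> x))"
        unfolding inner_projector[OF Ec vq x] using k by (simp add: E_def col_eigenmat)
      also have "\<dots> = (\<Sum>b<k. if Suc b = q then v q \<bullet> x else 0)"
        using q k by (intro sum.cong refl) (auto simp: v_orthonormal)
      also have "\<dots> = (\<Sum>j = 1..k. if j = q then v q \<bullet> x else 0)"
        using sum.atLeast1_atMost_eq[of "\<lambda>j. if j = q then v q \<bullet> x else 0" k] by simp
      also have "\<dots> = v q \<bullet> x" using q zero[OF a, of q] by (auto simp: x_def)
      finally show ?thesis unfolding r_def using vq x Ex by (simp add: scalar_prod_minus_distrib[of _ n])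
    qed
    have "r \<bullet> r = 0" unfolding parseval[OF r r, symmetric] using orth by simp
    then have r0: "r = 0\<^sub>v n" by (rule scalar_prod_self_eq_0[OF r])
    have "(E * E\<^sup>T) *\<^sub>v x = x"
    proof (rule eq_vecI)
      fix i assume i: "i < dim_vec x"
      have "r $ i = 0" unfolding r0 using i x by simp
      then show "((E * E\<^sup>T) *\<^sub>v x) $ i = x $ i" unfolding r_def using i x Ec by simp
    qed (use x EE in auto)
    moreover have "col (E * M) a = (E * E\<^sup>T) *\<^sub>v x"
    proof -
      have "E * M = E * E\<^sup>T * X"
        unfolding M_def using Ec Xc by (intro assoc_mult_mat[of _ n k _ n _ k, symmetric]) auto
      then show ?thesis unfolding x_def using Xc EE a by (auto intro!: eq_vecI)
    qed
    ultimately show "col (E * M) a = col X a" by (simp add: x_def)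
  qed (use Ec M Xc in auto)
  have "M\<^sup>T * M = 1\<^sub>m k"
  proof -
    have "M\<^sup>T = X\<^sup>T * E" unfolding M_def using Ec Xc by (simp add: transpose_mult[of _ k n _ k])
    then have "M\<^sup>T * M = X\<^sup>T * (E * M)"
      using Ec Xc M by (simp add: assoc_mult_mat[of _ k n _ k _ k])
    then show ?thesis using XE Xc by simp
  qed
  then have MM: "M * M\<^sup>T = 1\<^sub>m k" using M by (intro mat_mult_left_right_inverse[of "M\<^sup>T" k M]) auto
  have "X * M\<^sup>T = E * (M * M\<^sup>T)"
    unfolding XE[symmetric] using Ec M by (intro assoc_mult_mat[of _ n k _ k _ k]) auto
  then have EX: "X * M\<^sup>T = E" using MM Ec by simp
  have "vec_space.col_space n X \<subseteq> vec_space.col_space n E"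
    using col_space_mult_subset[OF Ec M] XE by simp
  moreover have "vec_space.col_space n E \<subseteq> vec_space.col_space n X"
    using col_space_mult_subset[OF Xc(1), of "M\<^sup>T" k] M EX by simp
  ultimately show ?thesis using E Xs by auto
qed

lemma represents_rep: "represents n k X W \<Longrightarrow> represents n k (rep n k W) W"
  unfolding rep_def by (rule someI)

text \<open>
  After the rotation of \<open>X0\<close> by the right singular vectors of \<open>E0\<^sup>T X0\<close>, the squared length of the
  \<open>a\<close>-th column splits into the squared singular value, which is \<open>cos\<^sup>2 \<theta>\<^sub>a\<close>, and the part in the trailing
  eigenvectors, which is therefore \<open>sin\<^sup>2 \<theta>\<^sub>a\<close>.
\<close>

lemma principal_angles_exist_and_defect:
  assumes X: "represents n k X W"
  shows "\<exists>\<theta>. principal_angles n k W leading_space \<theta>"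
    and "principal_angles n k W leading_space \<theta> \<Longrightarrow> (\<Sum>i<k. (sin (\<theta> i))\<^sup>2) = defect_of k X"
proof -
  define X0 where "X0 = rep n k W"
  define E0 where "E0 = rep n k leading_space"
  have X0: "represents n k X0 W" unfolding X0_def by (rule represents_rep[OF X])
  have E0: "represents n k E0 leading_space" unfolding E0_def by (rule represents_rep[OF eigenmat_represents])
  have st: "X0 \<in> stiefel n k" "E0 \<in> stiefel n k" using X0 E0 by (auto simp: represents_def)
  have c: "X0 \<in> carrier_mat n k" "E0 \<in> carrier_mat n k" using st by (auto simp: stiefel_def)
  have EE: "E0 * E0\<^sup>T = eigenmat k * (eigenmat k)\<^sup>T"
    by (rule projector_unique[OF E0 eigenmat_represents])
  define M where "M = E0\<^sup>T * X0"
  have M: "M \<in> carrier_mat k k" using c by (auto simp: M_def)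
  have key: "(s a)\<^sup>2 + (\<Sum>p = k + 1..n. (v p \<bullet> col (X0 * V) a)\<^sup>2) = 1"
    if svd: "compact_svd k k M U s V" and a: "a < k" for U s V a
  proof -
    have V: "V \<in> stiefel k k" "V \<in> carrier_mat k k" and U: "U \<in> stiefel k k" "U \<in> carrier_mat k k"
      using svd by (auto simp: compact_svd_def stiefel_def)
    define x where "x = col (X0 * V) a"
    have x: "x \<in> carrier_vec n" unfolding x_def using c V by (intro carrier_vecI) simp
    have unit: "x \<bullet> x = 1"
      using stiefel_mult(1)[OF st(1) V(1)] a unfolding x_def by (simp add: stiefel_iff)
    have Mv: "M *\<^sub>v col V a = E0\<^sup>T *\<^sub>v x"
    proof -
      have cv: "col V a \<in> carrier_vec k" using V a by auto
      have "x = X0 *\<^sub>v col V a" unfolding x_def using c V a by (intro eq_vecI) auto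
      then show ?thesis unfolding M_def using c cv by (simp add: assoc_mult_mat_vec[of _ k n _ k])
    qed
    have "(s a)\<^sup>2 = (s a \<cdot>\<^sub>v col U a) \<bullet> (s a \<cdot>\<^sub>v col U a)"
      using U(1) a by (simp add: stiefel_iff power2_eq_square)
    also have "\<dots> = (E0\<^sup>T *\<^sub>v x) \<bullet> (E0\<^sup>T *\<^sub>v x)"
      using singular_vectors_image[OF svd M a] Mv by simp
    also have "\<dots> = x \<bullet> ((E0 * E0\<^sup>T) *\<^sub>v x)"
    proof -
      have Ex: "E0\<^sup>T *\<^sub>v x \<in> carrier_vec k" using c x by auto
      have "(E0 * E0\<^sup>T) *\<^sub>v x = E0 *\<^sub>v (E0\<^sup>T *\<^sub>v x)"
        using c x by (simp add: assoc_mult_mat_vec[of _ n k _ n])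
      then show ?thesis using transpose_vec_mult_scalar[OF c(2) Ex x] by simp
    qed
    also have "\<dots> = (\<Sum>b<k. (x \<bullet> col (eigenmat k) b)\<^sup>2)"
      unfolding EE by (rule projection_norm_eq[OF eigenmat_carrier x, symmetric])
    finally show ?thesis using sum_leading_eigenvectors[OF x] unit unfolding x_def[symmetric] by simp
  qed
  show "\<exists>\<theta>. principal_angles n k W leading_space \<theta>"
  proof -
    obtain U s V where svd: "compact_svd k k M U s V"
      and decreasing: "\<forall>i j. i \<le> j \<and> j < k \<longrightarrow> s j \<le> s i"
      using compact_svd_exists[OF M] by auto
    have s0: "0 \<le> s a" if "a < k" for a using svd that by (simp add: compact_svd_def)
    have s1: "s a \<le> 1" if "a < k" for a
    proof -
      have "(s a)\<^sup>2 \<le> 1"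
        using key[OF svd that] sum_nonneg[of "{k + 1..n}" "\<lambda>p. (v p \<bullet> col (X0 * V) a)\<^sup>2"] by simp
      then show ?thesis using s0[OF that] by (simp add: power_le_one_iff)
    qed
    have cos_s: "cos (arccos (s a)) = s a" if "a < k" for a
      using s0[OF that] s1[OF that] by (intro cos_arccos) auto
    have "U * mat_diag k (\<lambda>i. cos (arccos (s i))) = U * mat_diag k s"
      using svd mat_diag_mult_right[of U k k]
      by (intro eq_matI) (auto simp: compact_svd_def stiefel_def cos_s)
    then have "compact_svd k k M U (\<lambda>i. cos (arccos (s i))) V"
      using svd cos_s by (simp add: compact_svd_def)
    moreover have "0 \<le> arccos (s i) \<and> arccos (s i) \<le> pi / 2" if "i < k" for i
      using s0[OF that] s1[OF that] by (intro conjI arccos_lbound arccos_le_pi2) auto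
    moreover have "arccos (s i) \<le> arccos (s j)" if "i \<le> j" "j < k" for i j
    proof -
      have "i < k" "s j \<le> s i" using that decreasing by auto
      then show ?thesis using s0[of i] s0[of j] s1[of i] s1[of j] that
        by (subst arccos_le_mono) auto
    qed
    ultimately have "principal_angles n k W leading_space (\<lambda>i. arccos (s i))"
      unfolding principal_angles_def M_def E0_def X0_def by blast
    then show ?thesis by blast
  qed
  assume "principal_angles n k W leading_space \<theta>"
  then obtain U V where svd: "compact_svd k k M U (\<lambda>i. cos (\<theta> i)) V"
    unfolding principal_angles_def M_def E0_def X0_def by blast
  then have V: "V \<in> stiefel k k" by (simp add: compact_svd_def)
  have "(\<Sum>i<k. (sin (\<theta> i))\<^sup>2) = defect_of k (X0 * V)"
    unfolding defect_of_def
  proof (intro sum.cong refl)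
    fix i assume "i \<in> {..<k}"
    then show "(sin (\<theta> i))\<^sup>2 = (\<Sum>p = k + 1..n. (v p \<bullet> col (X0 * V) i)\<^sup>2)"
      using key[OF svd, of i] sin_cos_squared_add[of "\<theta> i"] unfolding lessThan_iff by linarith
  qed
  also have "\<dots> = defect_of k X0"
    using stiefel_mult[OF st(1) V] c by (intro defect_of_cong) (auto simp: stiefel_def)
  also have "\<dots> = defect_of k X" by (rule defect_of_represents[OF X0 X])
  finally show "(\<Sum>i<k. (sin (\<theta> i))\<^sup>2) = defect_of k X" .
qed

lemma gr_dist_bounds:
  assumes X: "represents n k X W"
  shows "defect_of k X \<le> (gr_dist n k W leading_space)\<^sup>2"
    and "gr_dist n k W leading_space \<le> 2 * sqrt (defect_of k X)"
proof -
  define \<theta> where "\<theta> = (SOME \<theta>. principal_angles n k W leading_space \<theta>)"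
  have \<theta>: "principal_angles n k W leading_space \<theta>"
    unfolding \<theta>_def by (rule someI_ex[OF principal_angles_exist_and_defect(1)[OF X]])
  have dist: "gr_dist n k W leading_space = sqrt (\<Sum>i<k. (\<theta> i)\<^sup>2)"
    unfolding gr_dist_def \<theta>_def[symmetric] by simp
  have sq: "(gr_dist n k W leading_space)\<^sup>2 = (\<Sum>i<k. (\<theta> i)\<^sup>2)"
    unfolding dist by (simp add: sum_nonneg)
  have defect: "(\<Sum>i<k. (sin (\<theta> i))\<^sup>2) = defect_of k X"
    by (rule principal_angles_exist_and_defect(2)[OF X \<theta>])
  have "(\<Sum>i<k. (sin (\<theta> i))\<^sup>2) \<le> (\<Sum>i<k. (\<theta> i)\<^sup>2)"
    by (intro sum_mono) (simp add: abs_le_square_iff[symmetric] abs_sin_x_le_abs_x)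
  then show "defect_of k X \<le> (gr_dist n k W leading_space)\<^sup>2" unfolding sq defect .
  have "(\<Sum>i<k. (\<theta> i)\<^sup>2) \<le> (\<Sum>i<k. 4 * (sin (\<theta> i))\<^sup>2)"
    using \<theta> by (intro sum_mono angle_le_sin) (auto simp: principal_angles_def)
  also have "\<dots> = 4 * defect_of k X" by (simp add: defect sum_distrib_left[symmetric])
  finally have "sqrt (\<Sum>i<k. (\<theta> i)\<^sup>2) \<le> sqrt (4 * defect_of k X)" by simp
  then show "gr_dist n k W leading_space \<le> 2 * sqrt (defect_of k X)"
    unfolding dist by (simp add: real_sqrt_mult)
qed

end

section \<open>Linear convergence and the number of iterations\<close>

text \<open>
  The bound \<open>5/8\<close> on the defect is the condition under which a step contracts, and contraction preserves it.
\<close>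

lemma (in spectral_gap) defect_decay:
  assumes descent: "steepest_descent n k A (1 / \<gamma>) \<X>" and \<gamma>: "\<gamma> = 2 * (l 1 - l n)"
    and start: "gr_dist n k (\<X> 0) leading_space \<le> pi / 4"
  obtains X where "\<And>t. represents n k (X t) (\<X> t)" "\<And>t. defect_of k (X t) \<le> 5 / 8 * exp (- (3 * (l k - l (k + 1)) / (800 * \<gamma>)) * t)"
proof -
  define c where "c = 3 * (l k - l (k + 1)) / (800 * \<gamma>)"
  obtain X where X: "represents n k (X t) (\<X> t)"
      "\<X> (Suc t) = gr_exp n k (X t) ((- (1 / \<gamma>)) \<cdot>\<^sub>m rgrad n A (X t))" for t
    using descent unfolding steepest_descent_def by metis
  have c: "c = 3 * (l k - l (k + 1)) / (1600 * (l 1 - l n))" unfolding c_def \<gamma> by simp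
  have c_pos: "0 < c" unfolding c using spread_pos gap by simp
  have "defect_of k (X t) \<le> 5 / 8 * exp (- c * t)" for t
  proof (induction t)
    case 0
    have "defect_of k (X 0) \<le> (gr_dist n k (\<X> 0) leading_space)\<^sup>2"
      by (rule gr_dist_bounds(1)[OF X(1)])
    also have "\<dots> \<le> (pi / 4)\<^sup>2"
    proof (rule power_mono[OF start])
      show "0 \<le> gr_dist n k (\<X> 0) leading_space"
        unfolding gr_dist_def Let_def by (simp add: sum_nonneg)
    qed
    also have "\<dots> \<le> 5 / 8" by (rule pi_squared_le)
    finally show ?case by simp
  next
    case (Suc t)
    have nonneg: "0 \<le> defect_of k (X t)" unfolding defect_of_def by (intro sum_nonneg) auto
    have "exp (- c * t) \<le> 1" using c_pos by simp
    then have small: "defect_of k (X t) \<le> 5 / 8" using Suc.IH by linarith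
    have "X t \<in> stiefel n k" using X(1) by (simp add: represents_def)
    then have "defect_of k (X (Suc t)) \<le> (1 - c) * defect_of k (X t)"
      using defect_step[OF _ \<gamma> _ small, of "X (Suc t)"] X(1)[of "Suc t"] X(2)[of t] unfolding c by simp
    also have "\<dots> \<le> exp (- c) * defect_of k (X t)"
      using exp_ge_add_one_self[of "- c"] nonneg by (intro mult_right_mono) auto
    also have "\<dots> \<le> exp (- c) * (5 / 8 * exp (- c * t))"
      using Suc.IH by (intro mult_left_mono) auto
    also have "\<dots> = 5 / 8 * exp (- c * Suc t)" by (simp add: algebra_simps flip: exp_add)
    finally show ?case .
  qed
  then show ?thesis using that X(1) unfolding c_def by blast
qed

text \<open>
  The conditions on \<open>\<epsilon>\<close> under which the constant 2 and the rounding to an integer number of steps are absorbed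
  into a multiple of \<open>ln (M / \<epsilon>)\<close>.
\<close>

lemma ln_ratio_bounds:
  fixes M \<epsilon> :: real
  assumes "0 < M" "0 < \<epsilon>" "\<epsilon> < min 1 (min (M\<^sup>2 / 2) (M / 3))"
  shows "0 \<le> ln (2 / \<epsilon>)" "ln (2 / \<epsilon>) \<le> 2 * ln (M / \<epsilon>)" "1 \<le> ln (M / \<epsilon>)"
proof -
  have \<epsilon>: "\<epsilon> < 1" "2 * \<epsilon> < M\<^sup>2" "3 * \<epsilon> < M" using assms by auto
  show "0 \<le> ln (2 / \<epsilon>)" using \<epsilon> assms by (intro ln_ge_zero) (simp add: field_simps)
  have "2 / \<epsilon> \<le> (M / \<epsilon>)\<^sup>2"
  proof -
    have "2 * \<epsilon> / \<epsilon>\<^sup>2 \<le> M\<^sup>2 / \<epsilon>\<^sup>2" using \<epsilon> by (intro divide_right_mono) auto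
    moreover have "2 * \<epsilon> / \<epsilon>\<^sup>2 = 2 / \<epsilon>" using assms by (simp add: power2_eq_square)
    ultimately show ?thesis by (simp add: power_divide)
  qed
  then have "ln (2 / \<epsilon>) \<le> ln ((M / \<epsilon>)\<^sup>2)" using assms by (subst ln_le_cancel_iff) auto
  also have "\<dots> = 2 * ln (M / \<epsilon>)" using assms by (simp add: ln_realpow)
  finally show "ln (2 / \<epsilon>) \<le> 2 * ln (M / \<epsilon>)" .
  have "exp 1 * \<epsilon> \<le> 3 * \<epsilon>" using exp_le assms by (intro mult_right_mono) auto
  then have "exp 1 * \<epsilon> \<le> M" using \<epsilon> by linarith
  then have "exp 1 \<le> M / \<epsilon>" using assms by (simp only: pos_le_divide_eq)
  then show "1 \<le> ln (M / \<epsilon>)" using assms by (subst ln_ge_iff) auto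
qed

text \<open>
  The distance is at most twice the square root of the defect, so a defect of \<open>(\<epsilon>/2)\<^sup>2\<close> suffices; it is reached
  after about \<open>(2 / c) ln (2 / \<epsilon>)\<close> steps, where \<open>c = 3 \<delta> / (800 \<gamma>)\<close> is the rate of decay.
\<close>

lemma (in spectral_gap) iteration_count:
  assumes descent: "steepest_descent n k A (1 / \<gamma>) \<X>" and \<gamma>: "\<gamma> = 2 * (l 1 - l n)"
    and start: "gr_dist n k (\<X> 0) leading_space \<le> pi / 4"
    and M: "0 < M" and \<epsilon>: "0 < \<epsilon>" "\<epsilon> < min 1 (min (M\<^sup>2 / 2) (M / 3))"
  shows "\<exists>T::nat. T \<le> 1100 * (\<gamma> / (l k - l (k + 1))) * ln (M / \<epsilon>) \<and> gr_dist n k (\<X> T) leading_space \<le> \<epsilon>"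
proof -
  define \<delta> where "\<delta> = l k - l (k + 1)"
  define c where "c = 3 * \<delta> / (800 * \<gamma>)"
  obtain X where X: "\<And>t. represents n k (X t) (\<X> t)" "\<And>t. defect_of k (X t) \<le> 5 / 8 * exp (- c * t)"
    using defect_decay[OF descent \<gamma> start] unfolding c_def \<delta>_def by blast
  have \<delta>: "0 < \<delta>" using gap by (simp add: \<delta>_def)
  have \<gamma>_pos: "0 < \<gamma>" using spread_pos by (simp add: \<gamma>)
  have ratio: "1 \<le> \<gamma> / \<delta>"
    using \<delta> l_decreasing[of 1 k] l_decreasing[of "k + 1" n] k unfolding \<gamma> \<delta>_def by simp
  have c: "0 < c" using \<delta> \<gamma>_pos by (simp add: c_def)
  note ln_bounds = ln_ratio_bounds[OF M \<epsilon>]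
  define T where "T = nat \<lceil>2 / c * ln (2 / \<epsilon>)\<rceil>"
  have T_nonneg: "0 \<le> 2 / c * ln (2 / \<epsilon>)" using c ln_bounds(1) by simp
  have T: "2 / c * ln (2 / \<epsilon>) \<le> T" "T \<le> 2 / c * ln (2 / \<epsilon>) + 1"
    using T_nonneg unfolding T_def by linarith+
  have "2 / c * ln (2 / \<epsilon>) \<le> 2 / c * (2 * ln (M / \<epsilon>))"
    using ln_bounds(2) c by (intro mult_left_mono) auto
  also have "\<dots> = 3200 / 3 * (\<gamma> / \<delta>) * ln (M / \<epsilon>)" by (simp add: c_def)
  finally have "T \<le> 3200 / 3 * (\<gamma> / \<delta>) * ln (M / \<epsilon>) + 1" using T(2) by linarith
  moreover have "1 \<le> (\<gamma> / \<delta>) * ln (M / \<epsilon>)" using mult_mono[OF ratio ln_bounds(3)] ratio by simp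
  ultimately have count: "T \<le> 1100 * (\<gamma> / \<delta>) * ln (M / \<epsilon>)"
    unfolding mult.assoc by linarith
  have "ln (2 / \<epsilon>) * 2 \<le> c * T"
    using T(1) c by (simp add: field_simps)
  then have "- c * T \<le> 2 * ln (\<epsilon> / 2)" using \<epsilon>(1) by (simp add: ln_div)
  then have "exp (- c * T) \<le> exp (2 * ln (\<epsilon> / 2))" by (simp only: exp_le_cancel_iff)
  also have "\<dots> = (\<epsilon> / 2)\<^sup>2" using \<epsilon>(1) by (simp add: exp_double)
  finally have "defect_of k (X T) \<le> (\<epsilon> / 2)\<^sup>2"
    using X(2)[of T] zero_le_power2[of "\<epsilon> / 2"] by linarith
  then have "sqrt (defect_of k (X T)) \<le> \<epsilon> / 2" using \<epsilon>(1) by (intro real_le_lsqrt) auto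
  then have "gr_dist n k (\<X> T) leading_space \<le> \<epsilon>"
    using gr_dist_bounds(2)[OF X(1), of T] by linarith
  with count show ?thesis unfolding \<delta>_def by blast
qed

theorem theorem23:
  shows "\<exists>C::real. C > 0 \<and>
    (\<forall>(n::nat) (k::nat) (A::real mat) (l::nat \<Rightarrow> real) (v::nat \<Rightarrow> real vec)
       (\<delta>::real) (\<gamma>::real) (\<V>::real vec set) (\<X>\<^sub>0::real vec set).
      1 \<le> k \<and> k \<le> n - 1 \<and> pos_semidef n A \<and> eigensystem n A l v \<and>
      \<delta> = l k - l (k + 1) \<and> \<gamma> = 2 * (l 1 - l n) \<and> \<V> = vspan n (v ` {1..k}) \<and>
      \<delta> > 0 \<and> \<X>\<^sub>0 \<in> Gr n k \<and> \<X>\<^sub>0 \<noteq> \<V> \<and> gr_dist n k \<X>\<^sub>0 \<V> \<le> pi / 4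
      \<longrightarrow>
      (\<exists>\<epsilon>\<^sub>0>0. \<forall>\<X>::nat \<Rightarrow> real vec set.
         \<X> 0 = \<X>\<^sub>0 \<and> steepest_descent n k A (1 / \<gamma>) \<X> \<longrightarrow>
         (\<forall>\<epsilon>::real. 0 < \<epsilon> \<and> \<epsilon> < \<epsilon>\<^sub>0 \<longrightarrow>
           (\<exists>T::nat.
              real T \<le> C * (\<gamma> / \<delta>) * ln ((objective n k A \<X>\<^sub>0 - objective_min k l) / (\<delta> * \<epsilon>)) \<and>
              gr_dist n k (\<X> T) \<V> \<le> \<epsilon>))))"
proof (rule exI[of _ 1100], intro conjI allI impI)
  fix n k :: nat and A :: "real mat" and l :: "nat \<Rightarrow> real" and v :: "nat \<Rightarrow> real vec"
    and \<delta> \<gamma> :: real and \<V> \<X>\<^sub>0 :: "real vec set"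
  assume H: "1 \<le> k \<and> k \<le> n - 1 \<and> pos_semidef n A \<and> eigensystem n A l v \<and>
      \<delta> = l k - l (k + 1) \<and> \<gamma> = 2 * (l 1 - l n) \<and> \<V> = vspan n (v ` {1..k}) \<and>
      \<delta> > 0 \<and> \<X>\<^sub>0 \<in> Gr n k \<and> \<X>\<^sub>0 \<noteq> \<V> \<and> gr_dist n k \<X>\<^sub>0 \<V> \<le> pi / 4"
  interpret spectral_gap n A l v k
    using H by unfold_locales (auto simp: pos_semidef_def)
  have \<delta>: "\<delta> = l k - l (k + 1)" "0 < \<delta>" and \<gamma>: "\<gamma> = 2 * (l 1 - l n)" and \<V>: "\<V> = leading_space"
    using H by auto
  define M where "M = (objective n k A \<X>\<^sub>0 - objective_min k l) / \<delta>"
  \<comment> \<open>The threshold is chosen before a trajectory is given; once one exists, M is positive.\<close>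
  define \<epsilon>\<^sub>0 where "\<epsilon>\<^sub>0 = (if 0 < M then min 1 (min (M\<^sup>2 / 2) (M / 3)) else 1)"
  show "\<exists>\<epsilon>\<^sub>0>0. \<forall>\<X>. \<X> 0 = \<X>\<^sub>0 \<and> steepest_descent n k A (1 / \<gamma>) \<X> \<longrightarrow>
         (\<forall>\<epsilon>. 0 < \<epsilon> \<and> \<epsilon> < \<epsilon>\<^sub>0 \<longrightarrow>
           (\<exists>T::nat. real T \<le> 1100 * (\<gamma> / \<delta>) * ln ((objective n k A \<X>\<^sub>0 - objective_min k l) / (\<delta> * \<epsilon>)) \<and>
              gr_dist n k (\<X> T) \<V> \<le> \<epsilon>))"
  proof (rule exI[of _ \<epsilon>\<^sub>0], intro conjI allI impI)
    show "0 < \<epsilon>\<^sub>0" by (simp add: \<epsilon>\<^sub>0_def)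
    fix \<X> \<epsilon>
    assume \<X>: "\<X> 0 = \<X>\<^sub>0 \<and> steepest_descent n k A (1 / \<gamma>) \<X>" and \<epsilon>: "0 < \<epsilon> \<and> \<epsilon> < \<epsilon>\<^sub>0"
    obtain X where X: "represents n k X \<X>\<^sub>0"
      using \<X> unfolding steepest_descent_def by metis
    have rep: "represents n k (rep n k \<X>\<^sub>0) \<X>\<^sub>0" by (rule represents_rep[OF X])
    have "defect_of k (rep n k \<X>\<^sub>0) \<noteq> 0"
      using subspace_eq_leading_space[OF rep] H by auto
    moreover have "0 \<le> defect_of k (rep n k \<X>\<^sub>0)" unfolding defect_of_def by (intro sum_nonneg) auto
    ultimately have "0 < \<delta> * defect_of k (rep n k \<X>\<^sub>0)" using \<delta>(2) by simp
    then have M: "0 < M" using objective_gap_ge[OF rep] \<delta> unfolding M_def by simp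
    have "\<exists>T::nat. T \<le> 1100 * (\<gamma> / (l k - l (k + 1))) * ln (M / \<epsilon>) \<and> gr_dist n k (\<X> T) leading_space \<le> \<epsilon>"
      using \<X> H \<epsilon> M by (intro iteration_count[OF _ \<gamma>]) (auto simp: \<epsilon>\<^sub>0_def)
    then show "\<exists>T::nat. real T \<le> 1100 * (\<gamma> / \<delta>) * ln ((objective n k A \<X>\<^sub>0 - objective_min k l) / (\<delta> * \<epsilon>)) \<and>
        gr_dist n k (\<X> T) \<V> \<le> \<epsilon>"
      unfolding M_def \<V> \<delta>(1) by simp
  qed
qed simp

end
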